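(* Let $\Gamma$ be the Grigorchuk group and let $H$ be a finitely generated subgroup of $\Gamma$. Then $H$ is finite if and only if no vertex section of $H$ is equal to $\Gamma$.
   Context: Let $T$ be the $2$-regular rooted tree: its vertices are the finite words over the alphabet $\{0,1\}$, the root is the empty word, and each word $u$ is joined by an edge to $ux$ for every letter $x$. $\mathrm{Aut}\,T$ is the group of root-preserving automorphisms of $T$, acting on the right, $v\mapsto v^g$. An automorphism $x$ fixing both vertices of level $1$ is written $x=(x_0,x_1)$, where $x_i\in\mathrm{Aut}\,T$ is defined by $(iw)^x=i\,w^{x_i}$ for all words $w$. The (first) Grigorchuk group is $\Gamma=\langle a,b,c,d\rangle\le\mathrm{Aut}\,T$, where $a$ is defined by $(0w)^a=1w$, $(1w)^a=0w$ for all words $w$, and $b,c,d$ are defined recursively by $b=(a,c)$, $c=(a,d)$, $d=(1,b)$. For a vertex $v$ of $T$ and $x\in\mathrm{Aut}\,T$ with $v^x=v$, let $x_v\in\mathrm{Aut}\,T$ be the automorphism defined by $(vw)^x=v\,w^{x_v}$ for all words $w$. For a subgroup $H\le\mathrm{Aut}\,T$, the vertex section of $H$ at $v$ is the subgroup $H_v=\{x_v : x\in H,\ v^x=v\}$ of $\mathrm{Aut}\,T$. Vertex sections are taken over all vertices $v$ of $T$. *)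

theory Defs
  imports "HOL-Algebra.Generated_Groups"
begin

text \<open>
  Letters are booleans: \<^term>\<open>False\<close> is the letter 0 and \<^term>\<open>True\<close> is the letter 1.
\<close>

type_synonym word = "bool list"

definition tree_adj :: "word \<Rightarrow> word \<Rightarrow> bool" where
  "tree_adj u v \<longleftrightarrow> (\<exists>x. v = u @ [x]) \<or> (\<exists>x. u = v @ [x])"

definition tree_aut :: "(word \<Rightarrow> word) \<Rightarrow> bool" where
  "tree_aut f \<longleftrightarrow> bij f \<and> f [] = [] \<and> (\<forall>u v. tree_adj (f u) (f v) \<longleftrightarrow> tree_adj u v)"

text \<open>Right action: the product \<open>x y\<close> applies \<open>x\<close> first.\<close>

definition AutT :: "(word \<Rightarrow> word) monoid" where
  "AutT = \<lparr>carrier = {f. tree_aut f}, monoid.mult = (\<lambda>x y. y \<circ> x), one = id\<rparr>"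

fun grig_a :: "word \<Rightarrow> word" where
  "grig_a [] = []"
| "grig_a (False # w) = True # w"
| "grig_a (True # w) = False # w"

fun grig_b :: "word \<Rightarrow> word" and grig_c :: "word \<Rightarrow> word" and grig_d :: "word \<Rightarrow> word" where
  "grig_b [] = []"
| "grig_b (False # w) = False # grig_a w"
| "grig_b (True # w) = True # grig_c w"
| "grig_c [] = []"
| "grig_c (False # w) = False # grig_a w"
| "grig_c (True # w) = True # grig_d w"
| "grig_d [] = []"
| "grig_d (False # w) = False # w"
| "grig_d (True # w) = True # grig_b w"

definition grigorchuk_group :: "(word \<Rightarrow> word) set" where
  "grigorchuk_group = generate AutT {grig_a, grig_b, grig_c, grig_d}"

definition finitely_generated :: "('g, 'm) monoid_scheme \<Rightarrow> 'g set \<Rightarrow> bool" where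
  "finitely_generated G H \<longleftrightarrow> (\<exists>S. finite S \<and> S \<subseteq> carrier G \<and> H = generate G S)"

text \<open>
  For an automorphism \<open>x\<close> fixing \<open>v\<close>, \<open>section_at x v\<close> is the automorphism \<open>x\<^sub>v\<close>; see
  \<open>section_at_append\<close>, \<open>section_at_unique\<close> and \<open>section_at_tree_aut\<close> below.
  It carries no meaning when \<open>x\<close> moves \<open>v\<close>.
\<close>

definition section_at :: "(word \<Rightarrow> word) \<Rightarrow> word \<Rightarrow> word \<Rightarrow> word" where
  "section_at x v w = drop (length v) (x (v @ w))"

definition vertex_section :: "(word \<Rightarrow> word) set \<Rightarrow> word \<Rightarrow> (word \<Rightarrow> word) set" where
  "vertex_section H v = {section_at x v | x. x \<in> H \<and> x v = v}"

lemma tree_aut_adj: "tree_aut f \<Longrightarrow> tree_adj u v \<Longrightarrow> tree_adj (f u) (f v)"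
  by (simp add: tree_aut_def)

lemma tree_aut_child:
  assumes f: "tree_aut f"
  shows "\<exists>y. f (u @ [x]) = f u @ [y]"
proof (induction u arbitrary: x rule: rev_induct)
  case Nil
  have "tree_adj (f []) (f ([] @ [x]))"
    using tree_aut_adj[OF f] by (metis tree_adj_def)
  moreover have "f [] = []" using f by (simp add: tree_aut_def)
  ultimately show ?case by (auto simp: tree_adj_def)
next
  case (snoc z u)
  obtain y where y: "f (u @ [z]) = f u @ [y]" using snoc by blast
  have "tree_adj (f (u @ [z])) (f ((u @ [z]) @ [x]))"
    using tree_aut_adj[OF f] by (metis tree_adj_def)
  moreover have "f ((u @ [z]) @ [x]) \<noteq> f u"
    using f by (metis append_assoc append_self_conv bij_is_inj inj_eq snoc_eq_iff_butlast tree_aut_def)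
  ultimately show ?case using y by (auto simp: tree_adj_def)
qed

lemma tree_aut_append:
  assumes f: "tree_aut f"
  shows "\<exists>w'. f (v @ w) = f v @ w' \<and> length w' = length w"
proof (induction w rule: rev_induct)
  case (snoc x w)
  then obtain w' where w': "f (v @ w) = f v @ w'" "length w' = length w" by blast
  obtain y where "f ((v @ w) @ [x]) = f (v @ w) @ [y]" using tree_aut_child[OF f] by blast
  then show ?case using w' by (intro exI[of _ "w' @ [y]"]) simp
qed simp

lemma tree_aut_id: "tree_aut id"
  by (simp add: tree_aut_def)

lemma tree_aut_comp: "tree_aut f \<Longrightarrow> tree_aut g \<Longrightarrow> tree_aut (g \<circ> f)"
  by (auto simp: tree_aut_def intro: bij_comp)

lemma tree_aut_inv:
  assumes "tree_aut f"
  shows "tree_aut (inv_into UNIV f)"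
proof -
  have b: "bij f" using assms by (simp add: tree_aut_def)
  have "inv_into UNIV f [] = []" using assms b by (metis bij_inv_eq_iff tree_aut_def)
  moreover have "tree_adj (inv_into UNIV f u) (inv_into UNIV f v) = tree_adj u v" for u v
    using assms b by (metis bij_inv_eq_iff tree_aut_def)
  ultimately show ?thesis using b by (simp add: tree_aut_def bij_imp_bij_inv)
qed

lemma group_AutT: "group AutT"
proof (rule groupI)
  fix x assume "x \<in> carrier AutT"
  then have x: "tree_aut x" by (simp add: AutT_def)
  then have "inv_into UNIV x \<in> carrier AutT" "inv_into UNIV x \<otimes>\<^bsub>AutT\<^esub> x = \<one>\<^bsub>AutT\<^esub>"
    using tree_aut_inv[OF x] by (auto simp: AutT_def tree_aut_def bij_def surj_iff)
  then show "\<exists>y\<in>carrier AutT. y \<otimes>\<^bsub>AutT\<^esub> x = \<one>\<^bsub>AutT\<^esub>" by blast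
qed (auto simp: AutT_def tree_aut_comp tree_aut_id comp_assoc)

lemma section_at_append:
  assumes "tree_aut x" "x v = v"
  shows "x (v @ w) = v @ section_at x v w"
  using tree_aut_append[OF assms(1), of v w] assms(2) by (auto simp: section_at_def)

lemma section_at_unique:
  assumes "\<And>w. x (v @ w) = v @ y w"
  shows "section_at x v = y"
  using assms by (auto simp: section_at_def)

lemma section_at_tree_aut:
  assumes x: "tree_aut x" and v: "x v = v"
  shows "tree_aut (section_at x v)"
proof -
  note app = section_at_append[OF x v]
  have b: "bij x" using x by (simp add: tree_aut_def)
  have iv: "inv_into UNIV x v = v" using b v by (metis bij_inv_eq_iff)
  have "inj (section_at x v)"
    by (rule injI) (metis app b bij_is_inj inj_eq same_append_eq)
  moreover have "section_at x v (section_at (inv_into UNIV x) v w) = w" for w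
    using section_at_append[OF tree_aut_inv[OF x] iv, of w] app b
    by (metis bij_inv_eq_iff same_append_eq)
  then have "surj (section_at x v)" by (metis surjI)
  moreover have "section_at x v [] = []" using v by (simp add: section_at_def)
  moreover have "tree_adj (v @ u) (v @ w) = tree_adj u w" for u w
    by (simp add: tree_adj_def)
  then have "tree_adj (section_at x v u) (section_at x v w) = tree_adj u w" for u w
    using x app by (metis tree_aut_def)
  ultimately show ?thesis by (simp add: tree_aut_def bij_def)
qed

lemma tree_autI:
  assumes invol: "\<And>w. f (f w) = w" and nil: "f [] = []"
    and child: "\<And>u x. \<exists>y. f (u @ [x]) = f u @ [y]"
  shows "tree_aut f"
proof -
  have step: "tree_adj (f u) (f v)" if "tree_adj u v" for u v
    using that child by (auto simp: tree_adj_def)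
  have "tree_adj (f u) (f v) = tree_adj u v" for u v
    using step invol by metis
  moreover have "bij f" using invol by (intro o_bij[of f f]) auto
  ultimately show ?thesis using nil by (simp add: tree_aut_def)
qed

lemma grig_a_child: "\<exists>y. grig_a (u @ [x]) = grig_a u @ [y]"
  by (cases u rule: grig_a.cases; cases x) auto

lemma grig_bcd_child:
  "(\<exists>y. grig_b (u @ [x]) = grig_b u @ [y]) \<and> (\<exists>y. grig_c (u @ [x]) = grig_c u @ [y]) \<and>
   (\<exists>y. grig_d (u @ [x]) = grig_d u @ [y])"
proof (induction u)
  case Nil
  then show ?case by (cases x) auto
next
  case (Cons z u)
  then show ?case using grig_a_child[of u x] by (cases z) auto
qed

lemma grig_a_involution: "grig_a (grig_a w) = w"
  by (cases w rule: grig_a.cases) auto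

lemma grig_bcd_involution:
  "grig_b (grig_b w) = w \<and> grig_c (grig_c w) = w \<and> grig_d (grig_d w) = w"
proof (induction w)
  case (Cons z u)
  then show ?case by (cases z) (auto simp: grig_a_involution)
qed simp

lemma grig_generators_in_AutT: "{grig_a, grig_b, grig_c, grig_d} \<subseteq> carrier AutT"
  using grig_a_child grig_bcd_child grig_a_involution grig_bcd_involution
  by (auto simp: AutT_def intro!: tree_autI)

lemma subgroup_grigorchuk_group: "subgroup grigorchuk_group AutT"
  unfolding grigorchuk_group_def
  by (rule group.generate_is_subgroup[OF group_AutT grig_generators_in_AutT])

end

theory Submission
  imports Defs
begin

text \<open>
  A subgroup \<open>H\<close> acts on the group by left multiplication. A core of \<open>H\<close> is an \<open>H\<close>-invariant set \<open>Y\<close> of group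
  elements that is connected under right multiplication by \<open>a\<close> and by the Klein group \<open>{1, b, c, d}\<close>,
  closed under right multiplication by \<open>a\<close>, and consists of finitely many \<open>H\<close>-orbits. Every finitely
  generated \<open>H\<close> has one. Taking sections at a letter \<open>i\<close> of those elements of \<open>Y\<close> that send \<open>i\<close> to 0 and
  have an outgoing edge labelled \<open>b\<close> or \<open>c\<close> gives a core of the vertex section of \<open>H\<close> at \<open>i\<close>, unless
  that section is finite, and the number of orbits does not increase.

  An infinite \<open>H\<close> has an infinite section at 0 or at 1, so one can descend until the number of orbits
  is constant. In a stable step two elements with \<open>H\<^sub>i\<close>-equivalent sections are \<open>H\<close>-equivalent; as
  \<open>d\<close> has trivial section at 0, an edge labelled \<open>d\<close> stays in its orbit. Since \<open>c\<close> and \<open>b\<close> have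
  sections \<open>d\<close> and \<open>c\<close> at 1, three stable steps force all edges labelled \<open>b\<close>, \<open>c\<close>, \<open>d\<close> to stay in
  their orbits. Then \<open>Y\<close> is a single orbit, and up to conjugation \<open>H\<close> is generated by \<open>a\<close> and a
  subgroup of the Klein group, so \<open>H\<close> is finite or the whole group.
\<close>

section \<open>Tree automorphisms as a permutation of the letters with two sections\<close>

definition letter_image :: "(word \<Rightarrow> word) \<Rightarrow> bool \<Rightarrow> bool" where
  "letter_image f i = hd (f [i])"

definition sec :: "bool \<Rightarrow> (word \<Rightarrow> word) \<Rightarrow> word \<Rightarrow> word" where
  "sec i f = section_at f [i]"

lemma tree_aut_Cons:
  assumes f: "tree_aut f"
  shows "f (i # w) = letter_image f i # sec i f w"
proof -
  obtain u where "f ([] @ [i]) = f [] @ u" "length u = length [i]"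
    using tree_aut_append[OF f, of "[]" "[i]"] by blast
  moreover have "f [] = []" using f by (simp add: tree_aut_def)
  ultimately obtain j where j: "f [i] = [j]" by (auto simp: length_Suc_conv)
  obtain w' where "f ([i] @ w) = f [i] @ w'" using tree_aut_append[OF f, of "[i]" w] by blast
  then show ?thesis using j by (simp add: sec_def section_at_def letter_image_def)
qed

lemma tree_aut_letter: "tree_aut f \<Longrightarrow> f [i] = [letter_image f i]"
  using tree_aut_append[of f "[]" "[i]"] by (auto simp: tree_aut_def length_Suc_conv letter_image_def)

lemma tree_aut_inj: "tree_aut f \<Longrightarrow> f u = f v \<longleftrightarrow> u = v"
  by (metis bij_is_inj inj_eq tree_aut_def)

lemma letter_image_inj:
  assumes "tree_aut f" shows "letter_image f i = letter_image f j \<longleftrightarrow> i = j"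
  using tree_aut_letter[OF assms, of i] tree_aut_letter[OF assms, of j]
    tree_aut_inj[OF assms, of "[i]" "[j]"] by auto

lemma letter_image_comp: "tree_aut f \<Longrightarrow> letter_image (g \<circ> f) i = letter_image g (letter_image f i)"
  using tree_aut_letter[of f i] by (simp add: letter_image_def)

lemma sec_comp:
  assumes "tree_aut f" "tree_aut g"
  shows "sec i (g \<circ> f) = sec (letter_image f i) g \<circ> sec i f"
proof
  fix w
  have "sec i (g \<circ> f) w = drop 1 (g (f (i # w)))" by (simp add: sec_def section_at_def)
  also have "\<dots> = (sec (letter_image f i) g \<circ> sec i f) w"
    using tree_aut_Cons[OF assms(1), of i w] by (simp add: sec_def section_at_def)
  finally show "sec i (g \<circ> f) w = (sec (letter_image f i) g \<circ> sec i f) w" .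
qed

text \<open>Finiteness passes from sections to groups through this: letter images and sections
  together give an injective map on automorphisms.\<close>

lemma tree_aut_eqI:
  assumes "tree_aut f" "tree_aut g"
    and "\<And>i. letter_image f i = letter_image g i" "\<And>i. sec i f = sec i g"
  shows "f = g"
proof
  fix w show "f w = g w"
  proof (cases w)
    case (Cons i u)
    then show ?thesis
      using assms(3)[of i] assms(4)[of i] tree_aut_Cons[OF assms(1), of i u]
        tree_aut_Cons[OF assms(2), of i u] by simp
  qed (use assms in \<open>simp add: tree_aut_def\<close>)
qed

subsection \<open>Sections of the generators\<close>

lemma letter_image_generators [simp]:
  "letter_image grig_a i = (\<not> i)" "letter_image grig_b i = i"
  "letter_image grig_c i = i" "letter_image grig_d i = i" "letter_image id i = i"
  by (cases i; simp add: letter_image_def)+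

lemma sec_generators [simp]:
  "sec i grig_a = id" "sec False grig_b = grig_a" "sec True grig_b = grig_c"
  "sec False grig_c = grig_a" "sec True grig_c = grig_d"
  "sec False grig_d = id" "sec True grig_d = grig_b" "sec i id = id"
  by (cases i; auto simp: sec_def section_at_def fun_eq_iff)+

lemma tree_aut_generators [simp]:
  "tree_aut grig_a" "tree_aut grig_b" "tree_aut grig_c" "tree_aut grig_d" "tree_aut id"
  using grig_generators_in_AutT tree_aut_id by (auto simp: AutT_def)

lemma generators_involution [simp]:
  "grig_a \<circ> grig_a = id" "grig_b \<circ> grig_b = id" "grig_c \<circ> grig_c = id" "grig_d \<circ> grig_d = id"
  using grig_a_involution grig_bcd_involution by (auto simp: fun_eq_iff)

lemma generators_involution_comp [simp]:
  "grig_a \<circ> (grig_a \<circ> g) = g" "grig_b \<circ> (grig_b \<circ> g) = g"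
  "grig_c \<circ> (grig_c \<circ> g) = g" "grig_d \<circ> (grig_d \<circ> g) = g"
  using grig_a_involution grig_bcd_involution by (auto simp: fun_eq_iff)

text \<open>The induction must be joint: at letter 1, \<open>grig_b \<circ> grig_c = grig_d\<close>
  reduces to \<open>grig_c \<circ> grig_d = grig_b\<close>, that to
  \<open>grig_d \<circ> grig_b = grig_c\<close>, and that back to the first. The reversed products
  form a second such cycle.\<close>

lemma bcd_products_apply:
  "grig_b (grig_c w) = grig_d w \<and> grig_c (grig_b w) = grig_d w \<and>
   grig_b (grig_d w) = grig_c w \<and> grig_d (grig_b w) = grig_c w \<and>
   grig_c (grig_d w) = grig_b w \<and> grig_d (grig_c w) = grig_b w"
proof (induction w)
  case (Cons i w)
  then show ?case by (cases i) (auto simp: grig_a_involution)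
qed simp

lemma bcd_products [simp]:
  "grig_b \<circ> grig_c = grig_d" "grig_c \<circ> grig_b = grig_d" "grig_b \<circ> grig_d = grig_c"
  "grig_d \<circ> grig_b = grig_c" "grig_c \<circ> grig_d = grig_b" "grig_d \<circ> grig_c = grig_b"
  using bcd_products_apply by (auto simp: fun_eq_iff)

lemma bcd_products_comp [simp]:
  "grig_b \<circ> (grig_c \<circ> g) = grig_d \<circ> g" "grig_c \<circ> (grig_b \<circ> g) = grig_d \<circ> g"
  "grig_b \<circ> (grig_d \<circ> g) = grig_c \<circ> g" "grig_d \<circ> (grig_b \<circ> g) = grig_c \<circ> g"
  "grig_c \<circ> (grig_d \<circ> g) = grig_b \<circ> g" "grig_d \<circ> (grig_c \<circ> g) = grig_b \<circ> g"
  using bcd_products_apply by (auto simp: fun_eq_iff)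

definition klein :: "(word \<Rightarrow> word) set" where
  "klein = {id, grig_b, grig_c, grig_d}"

lemma klein_comp: "x \<in> klein \<Longrightarrow> y \<in> klein \<Longrightarrow> x \<circ> y \<in> klein"
  by (auto simp: klein_def)

lemma klein_involution: "x \<in> klein \<Longrightarrow> x \<circ> (x \<circ> g) = g"
  by (auto simp: klein_def)

lemma klein_tree_aut: "x \<in> klein \<Longrightarrow> tree_aut x"
  by (auto simp: klein_def)

lemma klein_letter_image: "x \<in> klein \<Longrightarrow> letter_image x i = i"
  by (auto simp: klein_def)

lemma klein_sec_True: "x \<in> klein \<Longrightarrow> sec True x \<in> klein"
  by (auto simp: klein_def)

lemma AutT_simps [simp]: "carrier AutT = {f. tree_aut f}" "x \<otimes>\<^bsub>AutT\<^esub> y = y \<circ> x" "\<one>\<^bsub>AutT\<^esub> = id"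
  by (auto simp: AutT_def)

lemma AutT_m_inv:
  assumes "tree_aut x" shows "x \<circ> inv\<^bsub>AutT\<^esub> x = id" "inv\<^bsub>AutT\<^esub> x \<circ> x = id"
  using group.l_inv[OF group_AutT, of x] group.r_inv[OF group_AutT, of x] assms by auto

lemma AutT_inv_involution: "tree_aut s \<Longrightarrow> s \<circ> s = id \<Longrightarrow> inv\<^bsub>AutT\<^esub> s = s"
  using group.inv_equality[OF group_AutT, of s s] by simp

text \<open>For a set of involutions the inverse rule of \<^term>\<open>generate\<close> is superfluous, and products can be
  built up one letter at a time.\<close>

lemma generate_involutions_induct:
  assumes g: "g \<in> generate AutT S" and S: "\<And>s. s \<in> S \<Longrightarrow> tree_aut s \<and> s \<circ> s = id"
    and one: "P id" and step: "\<And>s g. s \<in> S \<Longrightarrow> g \<in> generate AutT S \<Longrightarrow> P g \<Longrightarrow> P (s \<circ> g)"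
  shows "P g"
proof -
  \<comment> \<open>Stated for all translates, so that the product rule of \<open>generate\<close>
    merely composes two implications; \<open>k = id\<close> recovers the claim.\<close>
  have "\<forall>k \<in> generate AutT S. P k \<longrightarrow> P (g \<circ> k)"
    using g
  proof (induction rule: generate.induct)
    case (incl h)
    then show ?case using step by blast
  next
    case (inv h)
    then show ?case using step S AutT_inv_involution by metis
  next
    case (eng h1 h2)
    show ?case
    proof (intro ballI impI)
      fix k assume k: "k \<in> generate AutT S" "P k"
      have "h1 \<circ> k \<in> generate AutT S" using generate.eng[OF k(1) eng(1)] by simp
      then have "P (h2 \<circ> (h1 \<circ> k))" using k eng by blast
      then show "P (h1 \<otimes>\<^bsub>AutT\<^esub> h2 \<circ> k)" by (simp add: comp_assoc)
    qed
  qed simp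
  then show ?thesis using one generate.one[of AutT S] by fastforce
qed

lemma grig_generator_involution:
  "s \<in> {grig_a, grig_b, grig_c, grig_d} \<Longrightarrow> tree_aut s \<and> s \<circ> s = id"
  by auto

lemma grig_induct [consumes 1, case_names one step]:
  assumes g: "g \<in> grigorchuk_group" and one: "P id"
    and step: "\<And>s g. s \<in> {grig_a, grig_b, grig_c, grig_d} \<Longrightarrow> g \<in> grigorchuk_group \<Longrightarrow> P g \<Longrightarrow> P (s \<circ> g)"
  shows "P g"
  by (rule generate_involutions_induct[of g _ P, OF g[unfolded grigorchuk_group_def]
        grig_generator_involution one step[unfolded grigorchuk_group_def]])

lemma grig_tree_aut: "g \<in> grigorchuk_group \<Longrightarrow> tree_aut g"
  using subgroup.subset[OF subgroup_grigorchuk_group] by auto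

lemma grig_comp: "g \<in> grigorchuk_group \<Longrightarrow> h \<in> grigorchuk_group \<Longrightarrow> g \<circ> h \<in> grigorchuk_group"
  using subgroup.m_closed[OF subgroup_grigorchuk_group, of h g] by simp

lemma grig_generators [simp]:
  "grig_a \<in> grigorchuk_group" "grig_b \<in> grigorchuk_group" "grig_c \<in> grigorchuk_group"
  "grig_d \<in> grigorchuk_group" "id \<in> grigorchuk_group"
  using generate.one[of AutT] by (auto simp: grigorchuk_group_def intro: generate.incl)

text \<open>A section of a product is a product of sections of its factors, so generators suffice.
  Separate sets \<open>S\<close> and \<open>T\<close> cover both the whole group, with
  \<open>S = T\<close>, and the dihedral groups below, where they differ.\<close>

lemma generate_sec_closed:
  assumes S: "\<And>s. s \<in> S \<Longrightarrow> tree_aut s \<and> s \<circ> s = id" and T: "T \<subseteq> {f. tree_aut f}"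
    and sec: "\<And>s j. s \<in> S \<Longrightarrow> sec j s \<in> generate AutT T"
    and g: "g \<in> generate AutT S"
  shows "sec i g \<in> generate AutT T"
proof -
  have tS: "S \<subseteq> carrier AutT" using S by auto
  show ?thesis
  proof (rule generate_involutions_induct[OF g S])
    show "sec i id \<in> generate AutT T" using generate.one[of AutT T] by simp
  next
    fix s k assume *: "s \<in> S" "k \<in> generate AutT S" "sec i k \<in> generate AutT T"
    have "tree_aut k" using group.generate_in_carrier[OF group_AutT tS *(2)] by simp
    then show "sec i (s \<circ> k) \<in> generate AutT T"
      using * S generate.eng[OF *(3) sec[of s "letter_image k i"]] by (simp add: sec_comp)
  qed auto
qed

lemma grig_sec:
  assumes "g \<in> grigorchuk_group" shows "sec i g \<in> grigorchuk_group"
proof -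
  let ?S = "{grig_a, grig_b, grig_c, grig_d}"
  have "sec j s \<in> generate AutT ?S" if "s \<in> ?S" for s j
    using that by (cases j) (auto simp flip: grigorchuk_group_def)
  then show ?thesis
    using generate_sec_closed[of ?S ?S g i] assms grig_generator_involution
    unfolding grigorchuk_group_def by blast
qed

subsection \<open>Subgroups of the Grigorchuk group and their sections\<close>

definition grig_subgroup :: "(word \<Rightarrow> word) set \<Rightarrow> bool" where
  "grig_subgroup H \<longleftrightarrow> subgroup H AutT \<and> H \<subseteq> grigorchuk_group"

lemma grig_subgroup_tree_aut: "grig_subgroup H \<Longrightarrow> h \<in> H \<Longrightarrow> tree_aut h"
  using grig_tree_aut by (auto simp: grig_subgroup_def)

lemma grig_subgroup_id: "grig_subgroup H \<Longrightarrow> id \<in> H"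
  using subgroup.one_closed[of H AutT] by (simp add: grig_subgroup_def)

lemma grig_subgroup_comp: "grig_subgroup H \<Longrightarrow> g \<in> H \<Longrightarrow> h \<in> H \<Longrightarrow> g \<circ> h \<in> H"
  using subgroup.m_closed[of H AutT h g] by (simp add: grig_subgroup_def)

lemma grig_subgroup_inverse:
  assumes "grig_subgroup H" "h \<in> H"
  obtains h' where "h' \<in> H" "h \<circ> h' = id" "h' \<circ> h = id"
  using assms that[of "inv\<^bsub>AutT\<^esub> h"] AutT_m_inv[of h] grig_subgroup_tree_aut
    subgroup.m_inv_closed[of H AutT h] by (auto simp: grig_subgroup_def)

lemma vertex_section_letter:
  assumes "\<And>h. h \<in> H \<Longrightarrow> tree_aut h"
  shows "vertex_section H [i] = sec i ` {h \<in> H. letter_image h i = i}"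
proof -
  have "h [i] = [i] \<longleftrightarrow> letter_image h i = i" if "h \<in> H" for h
    using tree_aut_letter[OF assms[OF that], of i] by simp
  then show ?thesis by (auto simp: vertex_section_def sec_def)
qed

text \<open>\<open>sec i\<close> is a homomorphism on the stabiliser of the letter \<open>i\<close>,
  and \<open>grig_sec\<close> keeps its values in the Grigorchuk group.\<close>

lemma grig_subgroup_section:
  assumes H: "grig_subgroup H" shows "grig_subgroup (vertex_section H [i])"
proof -
  note ta = grig_subgroup_tree_aut[OF H]
  let ?K = "{h \<in> H. letter_image h i = i}"
  have eq: "vertex_section H [i] = sec i ` ?K" by (rule vertex_section_letter[OF ta])
  have grig: "vertex_section H [i] \<subseteq> grigorchuk_group"
    using H grig_sec by (auto simp: eq grig_subgroup_def)
  have "subgroup (vertex_section H [i]) AutT"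
  proof (rule group.subgroupI[OF group_AutT])
    show "vertex_section H [i] \<subseteq> carrier AutT" using grig grig_tree_aut by auto
    have "id \<in> ?K" using grig_subgroup_id[OF H] by simp
    then show "vertex_section H [i] \<noteq> {}" unfolding eq by blast
  next
    fix x assume "x \<in> vertex_section H [i]"
    then obtain h where h: "h \<in> H" "letter_image h i = i" "x = sec i h" by (auto simp: eq)
    obtain k where k: "k \<in> H" "h \<circ> k = id" "k \<circ> h = id" using grig_subgroup_inverse[OF H h(1)] .
    have ki: "letter_image k i = i"
      using letter_image_comp[OF ta[OF h(1)], of k i] h k by simp
    have "sec i k \<circ> x = id" "x \<circ> sec i k = id"
      using sec_comp[OF ta[OF h(1)] ta[OF k(1)], of i] sec_comp[OF ta[OF k(1)] ta[OF h(1)], of i] h k ki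
      by auto
    moreover have "tree_aut x" "tree_aut (sec i k)"
      using h k grig_tree_aut grig_sec H by (auto simp: grig_subgroup_def)
    ultimately have "inv\<^bsub>AutT\<^esub> x = sec i k"
      using group.inv_equality[OF group_AutT, of "sec i k" x] by simp
    then show "inv\<^bsub>AutT\<^esub> x \<in> vertex_section H [i]" using k ki by (auto simp: eq)
  next
    fix x y assume "x \<in> vertex_section H [i]" "y \<in> vertex_section H [i]"
    then obtain h k where h: "h \<in> H" "letter_image h i = i" "x = sec i h"
      and k: "k \<in> H" "letter_image k i = i" "y = sec i k" by (auto simp: eq)
    have "y \<circ> x = sec i (k \<circ> h)" "letter_image (k \<circ> h) i = i"
      using sec_comp[OF ta[OF h(1)] ta[OF k(1)], of i] letter_image_comp[OF ta[OF h(1)], of k i] h k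
      by auto
    moreover have "k \<circ> h \<in> H" using grig_subgroup_comp[OF H k(1) h(1)] .
    ultimately show "x \<otimes>\<^bsub>AutT\<^esub> y \<in> vertex_section H [i]" by (auto simp: eq)
  qed
  then show ?thesis using grig by (simp add: grig_subgroup_def)
qed

text \<open>Lets the descent go one letter at a time: what is found in a section of \<open>H\<close>
  is found in \<open>H\<close> at a longer word.\<close>

lemma vertex_section_Cons:
  assumes H: "grig_subgroup H"
  shows "vertex_section (vertex_section H [i]) v = vertex_section H (i # v)"
proof -
  note ta = grig_subgroup_tree_aut[OF H]
  have fixes_iff: "h (i # v) = i # v \<longleftrightarrow> h [i] = [i] \<and> sec i h v = v" if "h \<in> H" for h
    using tree_aut_Cons[OF ta[OF that], of i v] tree_aut_letter[OF ta[OF that], of i] by simp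
  have sect: "section_at (sec i h) v = section_at h (i # v)" for h
    by (simp add: sec_def section_at_def fun_eq_iff)
  have "vertex_section (vertex_section H [i]) v
      = {section_at (sec i h) v | h. h \<in> H \<and> h [i] = [i] \<and> sec i h v = v}"
    by (auto simp: vertex_section_def sec_def)
  then show ?thesis using fixes_iff by (auto simp: vertex_section_def sect)
qed

text \<open>The stabiliser of level 1 embeds in the product of the two sections and has index at
  most 2, so two finite sections would make \<open>H\<close> finite.\<close>

lemma infinite_section:
  assumes H: "grig_subgroup H" and inf: "infinite H"
  shows "\<exists>i. infinite (vertex_section H [i])"
proof (rule ccontr)
  assume "\<not> ?thesis"
  then have fin: "finite (vertex_section H [i])" for i by blast
  note ta = grig_subgroup_tree_aut[OF H]
  define K where "K = {h \<in> H. letter_image h False = False}"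
  have lt: "letter_image h i = i" if "h \<in> K" for h i
    using that letter_image_inj[OF ta, of h True False] by (cases i) (auto simp: K_def)
  have "inj_on (\<lambda>h. (sec False h, sec True h)) K"
  proof (rule inj_onI)
    fix g h assume *: "g \<in> K" "h \<in> K" "(sec False g, sec True g) = (sec False h, sec True h)"
    show "g = h"
    proof (rule tree_aut_eqI)
      show "tree_aut g" "tree_aut h" using * ta by (auto simp: K_def)
      show "letter_image g i = letter_image h i" for i using * lt by simp
      show "sec i g = sec i h" for i using * by (cases i) auto
    qed
  qed
  moreover have "(\<lambda>h. (sec False h, sec True h)) ` K \<subseteq> vertex_section H [False] \<times> vertex_section H [True]"
    using lt by (auto simp: vertex_section_letter[OF ta] K_def)
  ultimately have finK: "finite K"
    using fin by (meson finite_SigmaI finite_imageD finite_subset)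
  \<comment> \<open>If some \<open>t\<close> in \<open>H\<close> swaps the letters, everything
    outside \<open>K\<close> lies in the coset of \<open>K\<close> given by
    \<open>t\<close>.\<close>
  have "\<exists>t. H \<subseteq> K \<union> (\<lambda>k. t \<circ> k) ` K"
  proof (cases "H \<subseteq> K")
    case False
    then obtain t where t: "t \<in> H" "letter_image t False = True" by (auto simp: K_def)
    obtain s where s: "s \<in> H" "s \<circ> t = id" "t \<circ> s = id" using grig_subgroup_inverse[OF H t(1)] by metis
    have sT: "letter_image s True = False" using letter_image_comp[OF ta[OF t(1)], of s False] t s by simp
    have "h \<in> K \<union> (\<lambda>k. t \<circ> k) ` K" if h: "h \<in> H" "h \<notin> K" for h
    proof -
      have "letter_image h False = True" using h by (simp add: K_def)
      then have "s \<circ> h \<in> K"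
        using letter_image_comp[OF ta[OF h(1)], of s False] sT grig_subgroup_comp[OF H s(1) h(1)]
        by (simp add: K_def)
      moreover have "h = t \<circ> (s \<circ> h)" using s by (simp flip: comp_assoc)
      ultimately show ?thesis by blast
    qed
    then show ?thesis by blast
  qed auto
  then show False using finK inf finite_subset by blast
qed

subsection \<open>Orbits\<close>

text \<open>Elements act on the right, so \<open>g \<circ> h\<close> is the group product \<open>h g\<close> and \<open>orb H g\<close> is the coset \<open>H g\<close>.\<close>

definition orb :: "(word \<Rightarrow> word) set \<Rightarrow> (word \<Rightarrow> word) \<Rightarrow> (word \<Rightarrow> word) set" where
  "orb H g = (\<lambda>h. g \<circ> h) ` H"

lemma orb_self: "grig_subgroup H \<Longrightarrow> g \<in> orb H g"
  unfolding orb_def by (rule image_eqI[of _ _ id]) (auto intro: grig_subgroup_id)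

lemma orb_comp:
  assumes H: "grig_subgroup H" and h: "h \<in> H"
  shows "orb H (g \<circ> h) = orb H g"
proof -
  obtain k where k: "k \<in> H" "h \<circ> k = id" "k \<circ> h = id" using grig_subgroup_inverse[OF H h] .
  have "x = h \<circ> (k \<circ> x)" for x using k by (simp flip: comp_assoc)
  then have "(\<lambda>x. h \<circ> x) ` H = H"
    using grig_subgroup_comp[OF H h] grig_subgroup_comp[OF H k(1)] by blast
  then have "(\<lambda>x. g \<circ> x) ` (\<lambda>x. h \<circ> x) ` H = orb H g" by (simp add: orb_def)
  then show ?thesis by (simp add: orb_def image_image comp_assoc)
qed

lemma orb_eq_iff: "grig_subgroup H \<Longrightarrow> orb H g' = orb H g \<longleftrightarrow> (\<exists>h\<in>H. g' = g \<circ> h)"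
  by (metis (no_types, lifting) orb_self orb_comp orb_def imageE)

text \<open>Composing with \<open>x\<close> on the outside is right multiplication in the group,
  which commutes with the action of \<open>H\<close> from the left.\<close>

lemma orb_left: "orb H u = orb H w \<Longrightarrow> orb H (x \<circ> u) = orb H (x \<circ> w)"
proof -
  have "orb H (x \<circ> g) = (\<lambda>y. x \<circ> y) ` orb H g" for g
    by (simp add: orb_def image_image comp_assoc)
  then show "orb H u = orb H w \<Longrightarrow> ?thesis" by simp
qed

lemma orb_cancel_a: "orb H (grig_a \<circ> u) = orb H (grig_a \<circ> w) \<Longrightarrow> orb H u = orb H w"
  using orb_left[of H "grig_a \<circ> u" "grig_a \<circ> w" grig_a] by simp

subsection \<open>Cores\<close>

text \<open>The subgraph induced on \<open>Y\<close> in the Cayley graph for \<open>grig_a\<close>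
  and the Klein group; the label \<open>id\<close> only adds loops.\<close>

definition adj :: "(word \<Rightarrow> word) set \<Rightarrow> (word \<Rightarrow> word) \<Rightarrow> (word \<Rightarrow> word) \<Rightarrow> bool" where
  "adj Y g g' \<longleftrightarrow> g \<in> Y \<and> g' \<in> Y \<and> (\<exists>s \<in> insert grig_a klein. g' = s \<circ> g)"

text \<open>\<open>Y\<close> is the full preimage of a finite subgraph of the Schreier graph of
  \<open>H\<close>. Connectedness is demanded of the preimage, so each element of \<open>H\<close>
  can be read along a path inside \<open>Y\<close>.\<close>

definition core :: "(word \<Rightarrow> word) set \<Rightarrow> (word \<Rightarrow> word) set \<Rightarrow> bool" where
  "core H Y \<longleftrightarrow> grig_subgroup H \<and> Y \<noteq> {} \<and> Y \<subseteq> grigorchuk_group \<and>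
     (\<forall>g\<in>Y. grig_a \<circ> g \<in> Y) \<and> (\<forall>g\<in>Y. \<forall>h\<in>H. g \<circ> h \<in> Y) \<and>
     finite (orb H ` Y) \<and> (\<forall>g\<in>Y. \<forall>g'\<in>Y. (adj Y)\<^sup>*\<^sup>* g g')"

lemma coreD:
  assumes "core H Y"
  shows "grig_subgroup H" "Y \<noteq> {}" "g \<in> Y \<Longrightarrow> g \<in> grigorchuk_group" "g \<in> Y \<Longrightarrow> grig_a \<circ> g \<in> Y"
    "g \<in> Y \<Longrightarrow> h \<in> H \<Longrightarrow> g \<circ> h \<in> Y" "finite (orb H ` Y)"
    "g \<in> Y \<Longrightarrow> g' \<in> Y \<Longrightarrow> (adj Y)\<^sup>*\<^sup>* g g'"
  using assms by (auto simp: core_def)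

lemma core_tree_aut: "core H Y \<Longrightarrow> g \<in> Y \<Longrightarrow> tree_aut g"
  using coreD(3) grig_tree_aut by blast

lemma core_cancel: "core H Y \<Longrightarrow> g \<circ> h \<in> Y \<Longrightarrow> h \<in> H \<Longrightarrow> g \<in> Y"
  by (metis coreD(1,5) comp_assoc comp_id grig_subgroup_inverse)

lemma core_induct [consumes 3, case_names base a klein]:
  assumes Y: "core H Y" and g: "g \<in> Y" "g' \<in> Y" and base: "P g"
    and a: "\<And>u. u \<in> Y \<Longrightarrow> P u \<Longrightarrow> grig_a \<circ> u \<in> Y \<Longrightarrow> P (grig_a \<circ> u)"
    and klein: "\<And>u x. u \<in> Y \<Longrightarrow> P u \<Longrightarrow> x \<in> klein \<Longrightarrow> x \<circ> u \<in> Y \<Longrightarrow> P (x \<circ> u)"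
  shows "P g'"
  using coreD(7)[OF Y g]
proof (induction rule: rtranclp_induct)
  case (step u w)
  then show ?case using a klein by (auto simp: adj_def)
qed (rule base)

section \<open>The derived core at a letter\<close>

definition inner :: "(word \<Rightarrow> word) set \<Rightarrow> bool \<Rightarrow> (word \<Rightarrow> word) set" where
  "inner Y i = {g \<in> Y. (grig_b \<circ> g \<in> Y \<or> grig_c \<circ> g \<in> Y) \<and> letter_image g i = False}"

definition derived :: "(word \<Rightarrow> word) set \<Rightarrow> bool \<Rightarrow> (word \<Rightarrow> word) set" where
  "derived Y i = sec i ` inner Y i"

lemma letter_image_a: "tree_aut g \<Longrightarrow> letter_image (grig_a \<circ> g) i = (\<not> letter_image g i)"
  by (simp add: letter_image_comp)

lemma letter_image_klein: "tree_aut g \<Longrightarrow> x \<in> klein \<Longrightarrow> letter_image (x \<circ> g) i = letter_image g i"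
  by (simp add: letter_image_comp klein_letter_image)

lemma sec_a: "tree_aut g \<Longrightarrow> sec i (grig_a \<circ> g) = sec i g"
  by (simp add: sec_comp)

lemma sec_klein:
  assumes "tree_aut g" "x \<in> klein"
  shows "sec i (x \<circ> g) = sec (letter_image g i) x \<circ> sec i g"
  using assms by (simp add: sec_comp klein_tree_aut)

lemma inner_klein:
  assumes "g \<in> inner Y i" "x \<in> {grig_b, grig_c}" "x \<circ> g \<in> Y" "tree_aut g"
  shows "x \<circ> g \<in> inner Y i"
  using assms letter_image_klein[of g x i] by (auto simp: inner_def klein_def)

text \<open>An edge labelled \<open>grig_b\<close> or \<open>grig_c\<close> at an element sending
  \<open>i\<close> to 0 multiplies the section by \<open>grig_a\<close>, and its other end is again
  in \<open>inner Y i\<close>.\<close>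

lemma derived_a:
  assumes Y: "core H Y" and y: "y \<in> derived Y i"
  shows "grig_a \<circ> y \<in> derived Y i"
proof -
  obtain g where g: "g \<in> inner Y i" "y = sec i g" using y by (auto simp: derived_def)
  then obtain x where x: "x \<in> {grig_b, grig_c}" "x \<circ> g \<in> Y" by (auto simp: inner_def)
  have t: "tree_aut g" "letter_image g i = False" using g core_tree_aut[OF Y] by (auto simp: inner_def)
  have "sec i (x \<circ> g) = grig_a \<circ> y" using sec_klein[OF t(1), of x i] x g t by (auto simp: klein_def)
  then show ?thesis using inner_klein[OF g(1) x t(1)] unfolding derived_def by (metis imageI)
qed

text \<open>At letter 1 the Klein group has its sections in itself, and at letter 0
  \<open>id\<close> and \<open>grig_d\<close> have trivial section. Only \<open>grig_b\<close> and
  \<open>grig_c\<close> at letter 0 give \<open>grig_a\<close>, and then \<open>u\<close> is in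
  \<open>inner Y i\<close>.\<close>

lemma sec_step_klein:
  assumes Y: "core H Y" and u: "u \<in> Y" and x: "x \<in> klein" "x \<circ> u \<in> Y"
  obtains (stay) z where "z \<in> klein" "sec i (x \<circ> u) = z \<circ> sec i u"
    | (cross) "sec i u \<in> derived Y i" "sec i (x \<circ> u) = grig_a \<circ> sec i u"
proof (cases "letter_image u i \<or> x \<in> {id, grig_d}")
  case True
  then have "sec (letter_image u i) x \<in> klein"
    using klein_sec_True[OF x(1)] by (cases "letter_image u i") (auto simp: klein_def)
  then show ?thesis using stay sec_klein[OF core_tree_aut[OF Y u] x(1)] by blast
next
  case False
  then have x': "x = grig_b \<or> x = grig_c" and l: "letter_image u i = False"
    using x by (auto simp: klein_def)
  then have "u \<in> inner Y i" using u x by (auto simp: inner_def)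
  moreover have "sec (letter_image u i) x = grig_a" using x' l by auto
  ultimately show ?thesis
    using cross sec_klein[OF core_tree_aut[OF Y u] x(1), of i] by (simp add: derived_def)
qed

text \<open>Without crossings, all sections of elements of \<open>Y\<close> differ from that of one
  \<open>g0\<close> by Klein factors. Comparing \<open>g0\<close> with \<open>g0 \<circ> h\<close>
  leaves at most four sections of elements \<open>h\<close>.\<close>

lemma derived_empty_imp_finite:
  assumes Y: "core H Y" and e: "derived Y i = {}"
  shows "finite (vertex_section H [i])"
proof -
  obtain g0 where g0: "g0 \<in> Y" using coreD(2)[OF Y] by blast
  have one_class: "\<exists>x\<in>klein. sec i g = x \<circ> sec i g0" if "g \<in> Y" for g
    using Y g0 that
  proof (induction rule: core_induct)
    case base
    then show ?case by (auto simp: klein_def)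
  next
    case (a u)
    then show ?case using sec_a[OF core_tree_aut[OF Y]] by metis
  next
    case (klein u x)
    then show ?case
    proof (cases rule: sec_step_klein[OF Y klein(1-3), of i])
      case (1 z)
      then show ?thesis using klein(4) klein_comp by (metis comp_assoc)
    qed (use e in auto)
  qed
  have tree: "tree_aut (sec i g0)" using coreD(3)[OF Y g0] grig_sec grig_tree_aut by blast
  have "vertex_section H [i] \<subseteq> (\<lambda>x. inv\<^bsub>AutT\<^esub> (sec i g0) \<circ> (x \<circ> sec i g0)) ` klein"
  proof
    fix k assume "k \<in> vertex_section H [i]"
    then obtain h where h: "h \<in> H" "letter_image h i = i" "k = sec i h"
      using vertex_section_letter[of H i] grig_subgroup_tree_aut coreD(1)[OF Y] by auto
    have "sec i (g0 \<circ> h) = sec i g0 \<circ> k"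
      using sec_comp[of h g0 i] grig_subgroup_tree_aut[OF coreD(1)[OF Y] h(1)] core_tree_aut[OF Y g0] h
      by simp
    moreover obtain x where "x \<in> klein" "sec i (g0 \<circ> h) = x \<circ> sec i g0"
      using one_class coreD(5)[OF Y g0 h(1)] by blast
    moreover have "k = inv\<^bsub>AutT\<^esub> (sec i g0) \<circ> (sec i g0 \<circ> k)"
      using AutT_m_inv(2)[OF tree] by (simp flip: comp_assoc)
    ultimately show "k \<in> (\<lambda>x. inv\<^bsub>AutT\<^esub> (sec i g0) \<circ> (x \<circ> sec i g0)) ` klein"
      by (metis (no_types, lifting) imageI)
  qed
  moreover have "finite klein" by (simp add: klein_def)
  ultimately show ?thesis by (meson finite_imageI finite_subset)
qed

text \<open>Sections along a path in \<open>Y\<close> may leave \<open>derived Y i\<close>. The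
  induction therefore keeps a point \<open>z\<close> already reached there and one Klein factor
  leading to the current section; once the section is back in \<open>derived Y i\<close>, this
  factor is a single edge. Hence \<open>adj\<close> admits every Klein label.\<close>

lemma derived_connected:
  assumes Y: "core H Y" and y: "y1 \<in> derived Y i" "y2 \<in> derived Y i"
  shows "(adj (derived Y i))\<^sup>*\<^sup>* y1 y2"
proof -
  let ?R = "(adj (derived Y i))\<^sup>*\<^sup>*"
  obtain g1 g2 where g: "g1 \<in> Y" "y1 = sec i g1" "g2 \<in> Y" "y2 = sec i g2"
    using y by (auto simp: derived_def inner_def)
  have jump: "?R z (x \<circ> z)" if "z \<in> derived Y i" "x \<circ> z \<in> derived Y i" "x \<in> klein" for x z
    using that by (intro r_into_rtranclp) (auto simp: adj_def)
  have "\<exists>z\<in>derived Y i. ?R y1 z \<and> (\<exists>x\<in>klein. sec i g2 = x \<circ> z)"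
    using Y g(1,3)
  proof (induction rule: core_induct)
    case base
    then show ?case using y(1) g by (intro bexI[of _ y1]) (auto simp: klein_def)
  next
    case (a u)
    then show ?case using sec_a[OF core_tree_aut[OF Y]] by metis
  next
    case (klein u x)
    then obtain z v where z: "z \<in> derived Y i" "?R y1 z" "v \<in> klein" "sec i u = v \<circ> z" by blast
    show ?case
    proof (cases rule: sec_step_klein[OF Y klein(1-3), of i])
      case (1 w)
      then have "sec i (x \<circ> u) = (w \<circ> v) \<circ> z" using z by (simp add: comp_assoc)
      then show ?thesis using z klein_comp[OF 1(1) z(3)] by blast
    next
      case 2
      have "?R y1 (sec i u)" using z jump[of z v] 2 by simp
      moreover have "adj (derived Y i) (sec i u) (grig_a \<circ> sec i u)"
        using 2 derived_a[OF Y 2(1)] by (auto simp: adj_def)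
      ultimately have "?R y1 (grig_a \<circ> sec i u)" using rtranclp.rtrancl_into_rtrancl by metis
      moreover have "sec i (x \<circ> u) = id \<circ> (grig_a \<circ> sec i u)" "id \<in> klein"
        using 2 by (auto simp: klein_def)
      ultimately show ?thesis using derived_a[OF Y 2(1)] by blast
    qed
  qed
  then show ?thesis using jump y(2) g(4) by (metis rtranclp_trans)
qed

section \<open>Orbits of the derived core\<close>

definition derive_orbit :: "(word \<Rightarrow> word) set \<Rightarrow> (word \<Rightarrow> word) set \<Rightarrow> bool \<Rightarrow> (word \<Rightarrow> word) set \<Rightarrow> (word \<Rightarrow> word) set"
  where "derive_orbit H Y i A = orb (vertex_section H [i]) (sec i (SOME g. g \<in> A \<and> g \<in> inner Y i))"

text \<open>The choice of representative is immaterial: if \<open>g\<close> and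
  \<open>g \<circ> h\<close> both send \<open>i\<close> to 0, then \<open>h\<close> fixes
  \<open>i\<close>, and the sections differ by \<open>sec i h\<close>.\<close>

lemma derive_orbit:
  assumes Y: "core H Y" and g: "g \<in> inner Y i"
  shows "derive_orbit H Y i (orb H g) = orb (vertex_section H [i]) (sec i g)"
proof -
  note H = coreD(1)[OF Y] and ta = grig_subgroup_tree_aut[OF coreD(1)[OF Y]]
  define g' where "g' = (SOME u. u \<in> orb H g \<and> u \<in> inner Y i)"
  have "g' \<in> orb H g \<and> g' \<in> inner Y i"
    unfolding g'_def by (rule someI[of _ g]) (use g orb_self[OF H] in auto)
  then obtain h where h: "h \<in> H" "g' = g \<circ> h" "g' \<in> inner Y i" by (auto simp: orb_def)
  have tg: "tree_aut g" using g core_tree_aut[OF Y] by (auto simp: inner_def)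
  have "letter_image g i = letter_image g (letter_image h i)"
    using letter_image_comp[OF ta[OF h(1)], of g i] h g by (auto simp: inner_def)
  then have hi: "letter_image h i = i" using letter_image_inj[OF tg] by metis
  then have "sec i g' = sec i g \<circ> sec i h" using sec_comp[OF ta[OF h(1)] tg] h(2) by simp
  moreover have "sec i h \<in> vertex_section H [i]"
    using vertex_section_letter[of H i] ta h hi by auto
  ultimately show ?thesis
    unfolding derive_orbit_def g'_def[symmetric] using orb_comp[OF grig_subgroup_section[OF H]] by simp
qed

lemma derived_orbits:
  assumes Y: "core H Y"
  shows "orb (vertex_section H [i]) ` derived Y i = derive_orbit H Y i ` orb H ` inner Y i"
  using derive_orbit[OF Y] by (simp add: derived_def image_image)

lemma inner_subset: "inner Y i \<subseteq> Y"
  by (auto simp: inner_def)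

lemma inner_orbits_subset: "orb H ` inner Y i \<subseteq> orb H ` Y"
  using inner_subset by blast

lemma core_derived:
  assumes Y: "core H Y" and ne: "derived Y i \<noteq> {}"
  shows "core (vertex_section H [i]) (derived Y i)"
proof -
  note H = coreD(1)[OF Y] and ta = grig_subgroup_tree_aut[OF coreD(1)[OF Y]]
  have grig: "derived Y i \<subseteq> grigorchuk_group"
    using coreD(3)[OF Y] grig_sec by (auto simp: derived_def inner_def)
  have inv: "y \<circ> k \<in> derived Y i" if y: "y \<in> derived Y i" and k: "k \<in> vertex_section H [i]" for y k
  proof -
    obtain g where g: "g \<in> inner Y i" "y = sec i g" using y by (auto simp: derived_def)
    obtain h where h: "h \<in> H" "letter_image h i = i" "k = sec i h"
      using vertex_section_letter[of H i] ta k by auto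
    have tg: "tree_aut g" using g core_tree_aut[OF Y] by (auto simp: inner_def)
    have "g \<circ> h \<in> inner Y i"
      using g coreD(5)[OF Y _ h(1)] letter_image_comp[OF ta[OF h(1)], of g i] h(2)
      by (auto simp: inner_def simp flip: comp_assoc)
    moreover have "y \<circ> k = sec i (g \<circ> h)" using sec_comp[OF ta[OF h(1)] tg] g h by simp
    ultimately show ?thesis by (simp add: derived_def)
  qed
  have "finite (orb (vertex_section H [i]) ` derived Y i)"
    unfolding derived_orbits[OF Y] by (intro finite_imageI finite_subset[OF inner_orbits_subset coreD(6)[OF Y]])
  then show ?thesis
    unfolding core_def
    using grig_subgroup_section[OF H] ne grig derived_a[OF Y] inv derived_connected[OF Y] by blast
qed

lemma card_derived_orbits:
  assumes Y: "core H Y"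
  shows "card (orb (vertex_section H [i]) ` derived Y i) \<le> card (orb H ` Y)"
proof -
  have "finite (orb H ` inner Y i)" by (rule finite_subset[OF inner_orbits_subset coreD(6)[OF Y]])
  then have "card (orb (vertex_section H [i]) ` derived Y i) \<le> card (orb H ` inner Y i)"
    unfolding derived_orbits[OF Y] by (rule card_image_le)
  also have "\<dots> \<le> card (orb H ` Y)" by (rule card_mono[OF coreD(6)[OF Y] inner_orbits_subset])
  finally show ?thesis .
qed

section \<open>Stable steps\<close>

definition stable :: "(word \<Rightarrow> word) set \<Rightarrow> (word \<Rightarrow> word) set \<Rightarrow> bool \<Rightarrow> bool" where
  "stable H Y i \<longleftrightarrow> core H Y \<and> card (orb (vertex_section H [i]) ` derived Y i) = card (orb H ` Y)"

text \<open>Derived orbits are an image of the inner orbits, which are among all orbits. Equal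
  counts at both ends turn both inequalities into equalities.\<close>

lemma stable_inner_orbits:
  assumes "stable H Y i"
  shows "orb H ` inner Y i = orb H ` Y" "inj_on (derive_orbit H Y i) (orb H ` inner Y i)"
proof -
  have Y: "core H Y" using assms by (simp add: stable_def)
  let ?I = "orb H ` inner Y i"
  note sub = inner_orbits_subset[of H Y i] and fin = coreD(6)[OF Y]
  have finI: "finite ?I" by (rule finite_subset[OF sub fin])
  have eq: "card (derive_orbit H Y i ` ?I) = card (orb H ` Y)"
    using assms derived_orbits[OF Y] by (simp add: stable_def)
  have le: "card (derive_orbit H Y i ` ?I) \<le> card ?I" by (rule card_image_le[OF finI])
  have le': "card ?I \<le> card (orb H ` Y)" by (rule card_mono[OF fin sub])
  show "?I = orb H ` Y" by (rule card_subset_eq[OF fin sub]) (use eq le le' in simp)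
  show "inj_on (derive_orbit H Y i) ?I" by (rule eq_card_imp_inj_on[OF finI]) (use eq le le' in simp)
qed

lemma stable_inj:
  assumes S: "stable H Y i" and g: "g \<in> inner Y i" "g' \<in> inner Y i"
    and eq: "orb (vertex_section H [i]) (sec i g) = orb (vertex_section H [i]) (sec i g')"
  shows "orb H g = orb H g'"
proof -
  have "core H Y" using S by (simp add: stable_def)
  then show ?thesis
    using inj_onD[OF stable_inner_orbits(2)[OF S], of "orb H g" "orb H g'"] g eq derive_orbit by auto
qed

text \<open>Normalises an element within its orbit so that it sends \<open>i\<close> to 0.\<close>

lemma stable_shift:
  assumes S: "stable H Y i" and g: "g \<in> Y"
  obtains h where "h \<in> H" "g \<circ> h \<in> inner Y i"
proof -
  have Y: "core H Y" using S by (simp add: stable_def)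
  have "orb H g \<in> orb H ` inner Y i" using stable_inner_orbits(1)[OF S] g by blast
  then obtain u where u: "u \<in> inner Y i" "orb H u = orb H g" by auto
  moreover obtain h where "h \<in> H" "u = g \<circ> h" using u(2) orb_eq_iff[OF coreD(1)[OF Y], of u g] by blast
  ultimately show ?thesis using that by simp
qed

text \<open>Which edges leave an element depends only on its orbit, and every orbit meets
  \<open>inner Y i\<close>.\<close>

lemma stable_b_or_c:
  assumes S: "stable H Y i" and g: "g \<in> Y"
  shows "grig_b \<circ> g \<in> Y \<or> grig_c \<circ> g \<in> Y"
proof -
  have Y: "core H Y" using S by (simp add: stable_def)
  obtain h where h: "h \<in> H" "g \<circ> h \<in> inner Y i" using stable_shift[OF S g] .
  then have "grig_b \<circ> (g \<circ> h) \<in> Y \<or> grig_c \<circ> (g \<circ> h) \<in> Y" by (auto simp: inner_def)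
  then show ?thesis using core_cancel[OF Y _ h(1)] by (metis comp_assoc)
qed

lemma stable_inner_iff:
  "stable H Y i \<Longrightarrow> g \<in> inner Y i \<longleftrightarrow> g \<in> Y \<and> letter_image g i = False"
  using stable_b_or_c by (auto simp: inner_def)

definition absorbs :: "(word \<Rightarrow> word) set \<Rightarrow> (word \<Rightarrow> word) set \<Rightarrow> (word \<Rightarrow> word) \<Rightarrow> bool" where
  "absorbs H Y x \<longleftrightarrow> (\<forall>g\<in>Y. x \<circ> g \<in> Y \<longrightarrow> orb H (x \<circ> g) = orb H g)"

text \<open>After shifting so that \<open>i\<close> goes to 0, both ends of the edge are inner with
  the same section, so injectivity on orbits identifies their orbits.\<close>

lemma stable_absorbs_d:
  assumes S: "stable H Y i" shows "absorbs H Y grig_d"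
  unfolding absorbs_def
proof (intro ballI impI)
  fix g assume g: "g \<in> Y" "grig_d \<circ> g \<in> Y"
  have Y: "core H Y" using S by (simp add: stable_def)
  note H = coreD(1)[OF Y]
  obtain h where h: "h \<in> H" "g \<circ> h \<in> inner Y i" using stable_shift[OF S g(1)] .
  have t: "tree_aut (g \<circ> h)" and l: "letter_image (g \<circ> h) i = False"
    using core_tree_aut[OF Y] h(2) by (auto simp: inner_def)
  have "grig_d \<circ> (g \<circ> h) \<in> inner Y i"
    using coreD(5)[OF Y g(2) h(1)] letter_image_klein[OF t, of grig_d i] l
    by (simp add: stable_inner_iff[OF S] comp_assoc klein_def)
  moreover have "sec i (grig_d \<circ> (g \<circ> h)) = sec i (g \<circ> h)"
    using sec_klein[OF t, of grig_d i] l by (simp add: klein_def)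
  ultimately have "orb H (grig_d \<circ> (g \<circ> h)) = orb H (g \<circ> h)" using stable_inj[OF S _ h(2)] by metis
  then show "orb H (grig_d \<circ> g) = orb H g"
    using orb_comp[OF H h(1), of g] orb_comp[OF H h(1), of "grig_d \<circ> g"] by (simp add: comp_assoc)
qed

text \<open>The analogue at letter 1: the two sections now differ by \<open>sec True x\<close>, so
  their orbits agree one level down, and injectivity on orbits brings this back up.\<close>

lemma stable_absorbs_lift:
  assumes S: "stable H Y i" and x: "x \<in> klein"
    and next_level: "absorbs (vertex_section H [i]) (derived Y i) (sec True x)"
  shows "absorbs H Y x"
  unfolding absorbs_def
proof (intro ballI impI)
  fix g assume g: "g \<in> Y" "x \<circ> g \<in> Y"
  have Y: "core H Y" using S by (simp add: stable_def)
  note H = coreD(1)[OF Y]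
  \<comment> \<open>Shifting \<open>grig_a \<circ> g\<close> instead of \<open>g\<close> makes
    \<open>u\<close> below send \<open>i\<close> to 1; the factor \<open>grig_a\<close> does not
    change sections.\<close>
  obtain h where h: "h \<in> H" "(grig_a \<circ> g) \<circ> h \<in> inner Y i"
    using stable_shift[OF S coreD(4)[OF Y g(1)]] .
  define u where "u = g \<circ> h"
  have u: "u \<in> Y" "x \<circ> u \<in> Y" using coreD(5)[OF Y _ h(1)] g by (auto simp: u_def simp flip: comp_assoc)
  have au: "grig_a \<circ> u \<in> inner Y i" using h by (simp add: u_def comp_assoc)
  note t = core_tree_aut[OF Y u(1)] core_tree_aut[OF Y u(2)]
  have l: "letter_image u i" using au letter_image_a[OF t(1)] by (simp add: inner_def)
  have axu: "grig_a \<circ> (x \<circ> u) \<in> inner Y i"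
    using coreD(4)[OF Y u(2)] letter_image_a[OF t(2)] letter_image_klein[OF t(1) x] l
    by (simp add: stable_inner_iff[OF S])
  have s: "sec i (grig_a \<circ> (x \<circ> u)) = sec True x \<circ> sec i (grig_a \<circ> u)"
    using sec_a[OF t(1)] sec_a[OF t(2)] sec_klein[OF t(1) x] l by simp
  have "sec i (grig_a \<circ> u) \<in> derived Y i" "sec True x \<circ> sec i (grig_a \<circ> u) \<in> derived Y i"
    using au axu by (auto simp: derived_def simp flip: s)
  then have "orb H (grig_a \<circ> (x \<circ> u)) = orb H (grig_a \<circ> u)"
    using next_level stable_inj[OF S axu au] s by (simp add: absorbs_def)
  then have "orb H (x \<circ> u) = orb H u" by (rule orb_cancel_a)
  then show "orb H (x \<circ> g) = orb H g"
    using orb_comp[OF H h(1), of g] orb_comp[OF H h(1), of "x \<circ> g"] by (simp add: u_def comp_assoc)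
qed

subsection \<open>Three stable steps\<close>

text \<open>Stability absorbs \<open>grig_d\<close> at each level; lifting then gives
  \<open>grig_c\<close> at the cost of one further level and \<open>grig_b\<close> at the cost of
  two.\<close>

lemma stable_absorbs_klein:
  assumes S0: "stable H0 Y0 i0"
    and S1: "stable H1 Y1 i1" "H1 = vertex_section H0 [i0]" "Y1 = derived Y0 i0"
    and S2: "stable H2 Y2 i2" "H2 = vertex_section H1 [i1]" "Y2 = derived Y1 i1"
    and x: "x \<in> klein"
  shows "absorbs H0 Y0 x"
proof -
  have mem: "grig_b \<in> klein" "grig_c \<in> klein" by (auto simp: klein_def)
  have c1: "absorbs H1 Y1 grig_c"
    by (rule stable_absorbs_lift[OF S1(1) mem(2)]) (use stable_absorbs_d[OF S2(1)] S2 in simp)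
  have "absorbs H0 Y0 grig_c"
    by (rule stable_absorbs_lift[OF S0 mem(2)]) (use stable_absorbs_d[OF S1(1)] S1 in simp)
  moreover have "absorbs H0 Y0 grig_b"
    by (rule stable_absorbs_lift[OF S0 mem(1)]) (use c1 S1 in simp)
  ultimately show ?thesis
    using x stable_absorbs_d[OF S0] by (auto simp: klein_def absorbs_def)
qed

section \<open>Finiteness of the dihedral subgroups\<close>

lemma finite_generate_sections:
  assumes S: "\<And>s. s \<in> S \<Longrightarrow> tree_aut s \<and> s \<circ> s = id" and T: "T \<subseteq> {f. tree_aut f}"
    and sec: "\<And>s j. s \<in> S \<Longrightarrow> sec j s \<in> generate AutT T" and fin: "finite (generate AutT T)"
  shows "finite (generate AutT S)"
proof (rule finite_imageD)
  let ?G = "generate AutT S" and ?F = "\<lambda>g. (letter_image g False, letter_image g True, sec False g, sec True g)"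
  have "?F ` ?G \<subseteq> UNIV \<times> UNIV \<times> generate AutT T \<times> generate AutT T"
    using generate_sec_closed[OF S T sec] by auto
  then show "finite (?F ` ?G)" by (rule finite_subset) (simp add: fin)
  have S': "S \<subseteq> carrier AutT" using S by auto
  show "inj_on ?F ?G"
  proof (rule inj_onI)
    fix g h assume *: "g \<in> ?G" "h \<in> ?G" "?F g = ?F h"
    show "g = h"
    proof (rule tree_aut_eqI)
      show "tree_aut g" "tree_aut h" using group.generate_in_carrier[OF group_AutT S'] * by auto
      show "letter_image g i = letter_image h i" "sec i g = sec i h" for i
        using *(3) by (cases i; simp)+
    qed
  qed
qed

lemma finite_dihedral_step:
  assumes x: "x \<in> {grig_b, grig_c, grig_d}" and T: "T \<subseteq> {f. tree_aut f}" "finite (generate AutT T)"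
    and sec: "\<And>j. sec j x \<in> generate AutT T"
  shows "finite (generate AutT {grig_a, x})"
proof (rule finite_generate_sections[OF _ T(1) _ T(2)])
  show "tree_aut s \<and> s \<circ> s = id" if "s \<in> {grig_a, x}" for s using that x by auto
  show "sec j s \<in> generate AutT T" if "s \<in> {grig_a, x}" for s j
    using that sec generate.one[of AutT T] by auto
qed

text \<open>Finiteness climbs a chain of generating sets, \<open>{grig_b}\<close>,
  \<open>{grig_a, grig_d}\<close>, \<open>{grig_a, grig_c}\<close>, \<open>{grig_a, grig_b}\<close>:
  the sections of each lie in the group generated by the one before.\<close>

lemma finite_dihedral:
  assumes "x \<in> {grig_b, grig_c, grig_d}"
  shows "finite (generate AutT {grig_a, x})"
proof -
  have mem: "id \<in> generate AutT A" for A using generate.one[of AutT A] by simp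
  have inc: "s \<in> A \<Longrightarrow> s \<in> generate AutT A" for s A by (rule generate.incl)
  have "g = id \<or> g = grig_b" if "g \<in> generate AutT {grig_b}" for g
    using that
  proof (rule generate_involutions_induct)
    show "s \<circ> g = id \<or> s \<circ> g = grig_b" if "s \<in> {grig_b}" "g = id \<or> g = grig_b" for s g
      using that generators_involution(2) by (metis comp_id singletonD)
  qed auto
  then have "generate AutT {grig_b} \<subseteq> {id, grig_b}" by blast
  then have b: "finite (generate AutT {grig_b})" by (rule finite_subset) simp
  have "sec j grig_d \<in> generate AutT {grig_b}" for j using mem inc by (cases j) auto
  then have d: "finite (generate AutT {grig_a, grig_d})"
    by (intro finite_dihedral_step[OF _ _ b]) auto
  have "sec j grig_c \<in> generate AutT {grig_a, grig_d}" for j using inc by (cases j) auto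
  then have c: "finite (generate AutT {grig_a, grig_c})"
    by (intro finite_dihedral_step[OF _ _ d]) auto
  have "sec j grig_b \<in> generate AutT {grig_a, grig_c}" for j using inc by (cases j) auto
  then have "finite (generate AutT {grig_a, grig_b})"
    by (intro finite_dihedral_step[OF _ _ c]) auto
  then show ?thesis using assms c d by auto
qed

section \<open>Cores that absorb the Klein group\<close>

lemma grig_subgroup_grig: "grig_subgroup grigorchuk_group"
  by (simp add: grig_subgroup_def subgroup_grigorchuk_group)

lemma tree_aut_cancel: "tree_aut g \<Longrightarrow> g \<circ> u = g \<circ> w \<Longrightarrow> u = w"
  by (metis AutT_m_inv(2) comp_assoc id_comp)

text \<open>The hypothesis puts the conjugates of the generators by \<open>g\<close> into
  \<open>H\<close>. As \<open>g\<close> is in the Grigorchuk group, conjugation by it maps that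
  group onto itself.\<close>

lemma grig_subgroup_eq_grig:
  assumes H: "grig_subgroup H" and g: "g \<in> grigorchuk_group"
    and gens: "\<And>s. s \<in> {grig_a, grig_b, grig_c, grig_d} \<Longrightarrow> s \<circ> g \<in> orb H g"
  shows "H = grigorchuk_group"
proof
  show "H \<subseteq> grigorchuk_group" using H by (simp add: grig_subgroup_def)
  have all: "k \<circ> g \<in> orb H g" if "k \<in> grigorchuk_group" for k
    using that
  proof (induction rule: grig_induct)
    case one
    then show ?case using orb_self[OF H] by simp
  next
    case (step s k)
    obtain h where h: "h \<in> H" "k \<circ> g = g \<circ> h" using step(3) unfolding orb_def by blast
    obtain h' where h': "h' \<in> H" "s \<circ> g = g \<circ> h'" using gens[OF step(1)] unfolding orb_def by blast
    have "(s \<circ> k) \<circ> g = (s \<circ> g) \<circ> h" using h(2) by (simp add: comp_assoc)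
    also have "\<dots> = g \<circ> (h' \<circ> h)" using h'(2) by (simp add: comp_assoc)
    finally show ?case using grig_subgroup_comp[OF H h'(1) h(1)] unfolding orb_def by blast
  qed
  obtain g' where g': "g' \<in> grigorchuk_group" "g \<circ> g' = id" "g' \<circ> g = id"
    using grig_subgroup_inverse[OF grig_subgroup_grig g] .
  show "grigorchuk_group \<subseteq> H"
  proof
    fix k assume k: "k \<in> grigorchuk_group"
    have "(g \<circ> k \<circ> g') \<circ> g = g \<circ> k" using g'(3) by (simp add: comp_assoc)
    then have "g \<circ> k \<in> orb H g" using all[OF grig_comp[OF grig_comp[OF g k] g'(1)]] by simp
    then obtain h where "h \<in> H" "g \<circ> k = g \<circ> h" by (auto simp: orb_def)
    then show "k \<in> H" using tree_aut_cancel[OF grig_tree_aut[OF g]] by metis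
  qed
qed

lemma single_orbit:
  assumes S: "stable H Y i" and ab: "\<And>x. x \<in> klein \<Longrightarrow> absorbs H Y x" and g: "g \<in> Y" and g': "g' \<in> Y"
  shows "orb H g' = orb H g"
proof -
  have Y: "core H Y" using S by (simp add: stable_def)
  have klein_orb: "orb H (x \<circ> u) = orb H u" if "x \<in> klein" "u \<in> Y" "x \<circ> u \<in> Y" for x u
    using ab that by (auto simp: absorbs_def)
  text \<open>An edge labelled \<open>grig_a\<close> flips the image of \<open>i\<close>, other edges preserve it: unless \<open>g\<close> and
    \<open>grig_a \<circ> g\<close> are in the same orbit, that image would be constant on orbits.\<close>
  have parity: "(orb H u = orb H g \<and> letter_image u i = letter_image g i) \<or>
      (orb H u = orb H (grig_a \<circ> g) \<and> letter_image u i = (\<not> letter_image g i))" if "u \<in> Y" for u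
    using Y g that
  proof (induction rule: core_induct)
    case (a u)
    note l = letter_image_a[OF core_tree_aut[OF Y a(1)], of i]
    from a(3) show ?case
    proof
      assume *: "orb H u = orb H g \<and> letter_image u i = letter_image g i"
      then have "orb H (grig_a \<circ> u) = orb H (grig_a \<circ> g)" using orb_left by blast
      moreover have "letter_image (grig_a \<circ> u) i = (\<not> letter_image g i)" using * l by simp
      ultimately show ?thesis by blast
    next
      assume *: "orb H u = orb H (grig_a \<circ> g) \<and> letter_image u i = (\<not> letter_image g i)"
      then have "orb H (grig_a \<circ> u) = orb H (grig_a \<circ> (grig_a \<circ> g))" using orb_left by blast
      then have "orb H (grig_a \<circ> u) = orb H g" "letter_image (grig_a \<circ> u) i = letter_image g i"
        using * l by simp_all
      then show ?thesis by blast
    qed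
  next
    case (klein u x)
    have "orb H (x \<circ> u) = orb H u" "letter_image (x \<circ> u) i = letter_image u i"
      using klein_orb klein(1-3) letter_image_klein[OF core_tree_aut[OF Y klein(1)]] by auto
    then show ?case using klein(4) by metis
  qed simp
  have ag: "grig_a \<circ> g \<in> Y" using coreD(4)[OF Y g] .
  \<comment> \<open>Shifting \<open>g\<close> and \<open>grig_a \<circ> g\<close> produces elements
    of the orbit of \<open>g\<close> that send \<open>i\<close> to 0 and to 1. By parity, one of
    them is also in the orbit of \<open>grig_a \<circ> g\<close>.\<close>
  obtain h1 where h1: "h1 \<in> H" "g \<circ> h1 \<in> inner Y i" using stable_shift[OF S g] .
  obtain h2 where h2: "h2 \<in> H" "(grig_a \<circ> g) \<circ> h2 \<in> inner Y i" using stable_shift[OF S ag] .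
  have gh: "g \<circ> h1 \<in> Y" "g \<circ> h2 \<in> Y" using coreD(5)[OF Y g] h1 h2 by auto
  have "letter_image (g \<circ> h1) i = False" "letter_image (g \<circ> h2) i = True"
    using h1 h2 letter_image_a[OF core_tree_aut[OF Y gh(2)], of i] by (auto simp: inner_def comp_assoc)
  then have "orb H (grig_a \<circ> g) = orb H g"
    using parity[OF gh(1)] parity[OF gh(2)] orb_comp[OF coreD(1)[OF Y]] h1(1) h2(1)
    by (cases "letter_image g i") auto
  then show ?thesis using parity[OF g'] by auto
qed

text \<open>\<open>Y\<close> is a single orbit, so all its elements have the same outgoing labels.
  If \<open>grig_b\<close> and \<open>grig_c\<close> both occur, so does \<open>grig_d\<close>, and
  \<open>H\<close> is everything; otherwise only one Klein label \<open>x\<close> besides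
  \<open>id\<close> occurs, and \<open>Y\<close> is a translate of part of a finite dihedral
  group.\<close>

lemma stable_finite_or_full:
  assumes S: "stable H Y i" and ab: "\<And>x. x \<in> klein \<Longrightarrow> absorbs H Y x"
  shows "finite H \<or> H = grigorchuk_group"
proof -
  have Y: "core H Y" using S by (simp add: stable_def)
  note H = coreD(1)[OF Y]
  obtain g where g: "g \<in> Y" using coreD(2)[OF Y] by blast
  have in_orb: "u \<in> orb H g" if "u \<in> Y" for u
    using single_orbit[OF S ab g that] orb_self[OF H, of u] by simp
  show ?thesis
  proof (cases "grig_b \<circ> g \<in> Y \<and> grig_c \<circ> g \<in> Y")
    case True
    then obtain h where h: "h \<in> H" "grig_c \<circ> g = g \<circ> h" using in_orb by (auto simp: orb_def)
    have "(grig_b \<circ> g) \<circ> h = grig_d \<circ> g" using h(2) by (simp add: comp_assoc flip: h(2))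
    then have "grig_d \<circ> g \<in> Y" using coreD(5)[OF Y _ h(1), of "grig_b \<circ> g"] True by simp
    then have "s \<circ> g \<in> orb H g" if "s \<in> {grig_a, grig_b, grig_c, grig_d}" for s
      using that True coreD(4)[OF Y g] in_orb by auto
    then show ?thesis using grig_subgroup_eq_grig[OF H coreD(3)[OF Y g]] by blast
  next
    case False
    define x where "x = (if grig_b \<circ> g \<in> Y then grig_b else grig_c)"
    define x' where "x' = (if grig_b \<circ> g \<in> Y then grig_c else grig_b)"
    have x: "x \<circ> g \<in> Y" "x' \<circ> g \<notin> Y" "x \<circ> (grig_d \<circ> g) = x' \<circ> g" "klein = {id, x, x', grig_d}"
      using stable_b_or_c[OF S g] False by (auto simp: x_def x'_def klein_def)
    \<comment> \<open>An edge labelled \<open>grig_d\<close> would translate the edge labelled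
      \<open>x\<close> into one labelled \<open>x'\<close>.\<close>
    have "grig_d \<circ> g \<notin> Y"
    proof
      assume "grig_d \<circ> g \<in> Y"
      then obtain h where h: "h \<in> H" "grig_d \<circ> g = g \<circ> h" using in_orb by (auto simp: orb_def)
      then have "(x \<circ> g) \<circ> h = x' \<circ> g" using x(3) by (simp add: comp_assoc)
      then show False using coreD(5)[OF Y x(1) h(1)] x(2) by simp
    qed
    then have only: "z \<in> {id, x}" if "z \<in> klein" "z \<circ> g \<in> Y" for z using that x by auto
    let ?G = "generate AutT {grig_a, x}"
    have id: "id \<in> ?G" using generate.one[of AutT "{grig_a, x}"] by simp
    have comp: "s \<circ> k \<in> ?G" if "s \<in> ?G" "k \<in> ?G" for s k using generate.eng[OF that(2,1)] by simp
    have "\<exists>k\<in>?G. u = k \<circ> g" if "u \<in> Y" for u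
      using Y g that
    proof (induction rule: core_induct)
      case base
      show ?case by (rule bexI[OF _ id]) simp
    next
      case (a u)
      then obtain k where k: "k \<in> ?G" "u = k \<circ> g" by blast
      have "grig_a \<in> ?G" by (rule generate.incl) simp
      then have "grig_a \<circ> k \<in> ?G" by (rule comp[OF _ k(1)])
      then show ?case by (rule bexI[rotated]) (simp add: k(2) comp_assoc)
    next
      case (klein u z)
      then obtain k where k: "k \<in> ?G" "u = k \<circ> g" by blast
      obtain h where h: "h \<in> H" "u = g \<circ> h" using in_orb[OF klein(1)] by (auto simp: orb_def)
      \<comment> \<open>The label \<open>z\<close> at \<open>u\<close> is carried back to
        \<open>g\<close> by the invariance of \<open>Y\<close>.\<close>
      have "z \<circ> g \<in> Y" using core_cancel[OF Y _ h(1), of "z \<circ> g"] klein(3) h(2) by (simp add: comp_assoc)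
      then have "z = id \<or> z = x" using only klein(2) by blast
      moreover have "x \<in> ?G" by (rule generate.incl) simp
      ultimately have "z \<in> ?G" using id by metis
      then have "z \<circ> k \<in> ?G" by (rule comp[OF _ k(1)])
      then show ?case by (rule bexI[rotated]) (simp add: k(2) comp_assoc)
    qed
    then have sub: "Y \<subseteq> (\<lambda>k. k \<circ> g) ` ?G" by blast
    have "finite ?G" by (rule finite_dihedral) (simp add: x_def)
    then have finY: "finite Y" by (intro finite_subset[OF sub] finite_imageI)
    have "(\<lambda>h. g \<circ> h) ` H \<subseteq> Y" using coreD(5)[OF Y g] by blast
    then have "finite ((\<lambda>h. g \<circ> h) ` H)" by (rule finite_subset[OF _ finY])
    moreover have "inj_on (\<lambda>h. g \<circ> h) H"
      using tree_aut_cancel[OF core_tree_aut[OF Y g]] by (auto simp: inj_on_def)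
    ultimately have "finite H" by (rule finite_imageD)
    then show ?thesis ..
  qed
qed

section \<open>Descent to a full section\<close>

lemma descend:
  assumes Y: "core H Y" and inf: "infinite H"
  obtains i where "infinite (vertex_section H [i])" "core (vertex_section H [i]) (derived Y i)"
    "card (orb (vertex_section H [i]) ` derived Y i) < card (orb H ` Y) \<or> stable H Y i"
proof -
  obtain i where i: "infinite (vertex_section H [i])" using infinite_section[OF coreD(1)[OF Y] inf] by blast
  have core: "core (vertex_section H [i]) (derived Y i)"
    using core_derived[OF Y] derived_empty_imp_finite[OF Y] i by blast
  show ?thesis
    by (rule that[OF i core]) (use card_derived_orbits[OF Y, of i] Y in \<open>auto simp: stable_def\<close>)
qed

lemma vertex_section_Nil: "grig_subgroup H \<Longrightarrow> vertex_section H [] = H"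
proof -
  assume H: "grig_subgroup H"
  have "section_at h [] = h" for h by (simp add: section_at_def fun_eq_iff)
  moreover have "h [] = []" if "h \<in> H" for h
    using grig_subgroup_tree_aut[OF H that] by (simp add: tree_aut_def)
  ultimately show ?thesis by (auto simp: vertex_section_def)
qed

text \<open>Induction on the number of orbits, looking three levels down. Either the number has
  dropped at some level, or all three steps are stable and \<open>H\<close> itself is full, with
  \<open>v = []\<close>.\<close>

lemma core_full_section:
  assumes "core H Y" and "infinite H"
  shows "\<exists>v. vertex_section H v = grigorchuk_group"
  using assms
proof (induction "card (orb H ` Y)" arbitrary: H Y rule: less_induct)
  case less
  note H = coreD(1)[OF less(2)]
  obtain i0 where i0: "infinite (vertex_section H [i0])" "core (vertex_section H [i0]) (derived Y i0)"
    "card (orb (vertex_section H [i0]) ` derived Y i0) < card (orb H ` Y) \<or> stable H Y i0"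
    using descend[OF less(2,3)] .
  define H1 Y1 where 1: "H1 = vertex_section H [i0]" "Y1 = derived Y i0"
  note H1 = grig_subgroup_section[OF H, of i0, folded 1]
  obtain i1 where i1: "infinite (vertex_section H1 [i1])" "core (vertex_section H1 [i1]) (derived Y1 i1)"
    "card (orb (vertex_section H1 [i1]) ` derived Y1 i1) < card (orb H1 ` Y1) \<or> stable H1 Y1 i1"
    using descend[OF i0(2,1), folded 1] .
  define H2 Y2 where 2: "H2 = vertex_section H1 [i1]" "Y2 = derived Y1 i1"
  note H2 = grig_subgroup_section[OF H1, of i1, folded 2]
  obtain i2 where i2: "infinite (vertex_section H2 [i2])" "core (vertex_section H2 [i2]) (derived Y2 i2)"
    "card (orb (vertex_section H2 [i2]) ` derived Y2 i2) < card (orb H2 ` Y2) \<or> stable H2 Y2 i2"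
    using descend[OF i1(2,1), folded 2] .
  have up1: ?case if "\<exists>v. vertex_section H1 v = grigorchuk_group"
    using that vertex_section_Cons[OF H, of i0] 1 by metis
  have up2: ?case if "\<exists>v. vertex_section H2 v = grigorchuk_group"
    using that vertex_section_Cons[OF H1, of i1] 2 up1 by metis
  have le: "card (orb H1 ` Y1) \<le> card (orb H ` Y)" "card (orb H2 ` Y2) \<le> card (orb H1 ` Y1)"
    using card_derived_orbits[OF less(2), of i0] card_derived_orbits[OF i0(2), of i1] 1 2 by auto
  show ?case
  proof (cases "stable H Y i0 \<and> stable H1 Y1 i1 \<and> stable H2 Y2 i2")
    case True
    then have "absorbs H Y x" if "x \<in> klein" for x using stable_absorbs_klein that 1 2 by blast
    then have "H = grigorchuk_group" using stable_finite_or_full[of H Y i0] less(3) True by blast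
    then show ?thesis using vertex_section_Nil[OF H] by blast
  next
    case False
    \<comment> \<open>Since the numbers never increase, a drop at any of the three steps is a drop
      below the number for \<open>H\<close>.\<close>
    then consider "card (orb H1 ` Y1) < card (orb H ` Y)" | "card (orb H2 ` Y2) < card (orb H ` Y)"
      | "card (orb (vertex_section H2 [i2]) ` derived Y2 i2) < card (orb H ` Y)"
      using i0(3) i1(3) i2(3) le 1 2 by force
    then show ?thesis
    proof cases
      case 1
      then show ?thesis using less(1)[OF _ i0(2,1)] up1 \<open>H1 = _\<close> \<open>Y1 = _\<close> by simp
    next
      case 2
      then show ?thesis using less(1)[OF _ i1(2,1)] up2 \<open>H2 = _\<close> \<open>Y2 = _\<close> by simp
    next
      case 3
      then show ?thesis using less(1)[OF _ i2(2,1)] up2 vertex_section_Cons[OF H2, of i2] by metis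
    qed
  qed
qed

subsection \<open>Finitely generated subgroups have cores\<close>

lemma adj_sym: "adj Y g g' \<Longrightarrow> adj Y g' g"
proof -
  assume *: "adj Y g g'"
  then obtain s where s: "s \<in> insert grig_a klein" "g' = s \<circ> g" by (auto simp: adj_def)
  then have "g = s \<circ> g'" using klein_involution[of s g] by auto
  then show ?thesis using * s by (auto simp: adj_def)
qed

lemma adj_rtranclp_sym: "(adj Y)\<^sup>*\<^sup>* g g' \<Longrightarrow> (adj Y)\<^sup>*\<^sup>* g' g"
  by (metis adj_sym sympD sympI symp_rtranclp)

lemma adj_rtranclp_mono: "(adj B)\<^sup>*\<^sup>* g g' \<Longrightarrow> B \<subseteq> Y \<Longrightarrow> (adj Y)\<^sup>*\<^sup>* g g'"
  by (erule rtranclp_mono[THEN predicate2D, rotated]) (auto simp: adj_def)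

text \<open>Translation by \<open>h\<close> acts on the other side from the labels and so preserves
  them.\<close>

lemma adj_rtranclp_translate:
  assumes "(adj Y)\<^sup>*\<^sup>* g g'" and Y: "\<And>u. u \<in> Y \<Longrightarrow> u \<circ> h \<in> Y"
  shows "(adj Y)\<^sup>*\<^sup>* (g \<circ> h) (g' \<circ> h)"
  using assms(1)
proof (induction rule: rtranclp_induct)
  case (step u w)
  then obtain s where s: "s \<in> insert grig_a klein" "w = s \<circ> u" "u \<in> Y" "w \<in> Y" by (auto simp: adj_def)
  have "w \<circ> h = s \<circ> (u \<circ> h)" using s(2) by (simp add: comp_assoc)
  then have "adj Y (u \<circ> h) (w \<circ> h)" unfolding adj_def using s Y by blast
  then show ?case using step(3) by (rule rtranclp.rtrancl_into_rtrancl[rotated])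
qed simp

text \<open>A word for \<open>g\<close> spells a path from \<open>id\<close>; adding the
  \<open>grig_a\<close>-neighbour of each vertex keeps it connected and closes it under
  \<open>grig_a\<close>.\<close>

lemma finite_connected_set:
  assumes "g \<in> grigorchuk_group"
  shows "\<exists>B. finite B \<and> B \<subseteq> grigorchuk_group \<and> id \<in> B \<and> g \<in> B \<and> (\<forall>u\<in>B. grig_a \<circ> u \<in> B)
    \<and> (\<forall>u\<in>B. (adj B)\<^sup>*\<^sup>* id u)"
  using assms
proof (induction rule: grig_induct)
  case one
  let ?B = "{id, grig_a}"
  have "adj ?B id grig_a" by (auto simp: adj_def)
  then have "\<forall>u\<in>?B. (adj ?B)\<^sup>*\<^sup>* id u" by simp
  moreover have "\<forall>u\<in>?B. grig_a \<circ> u \<in> ?B" by simp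
  moreover have "finite ?B" "?B \<subseteq> grigorchuk_group" "id \<in> ?B" by simp_all
  ultimately show ?case by blast
next
  case (step s g)
  then obtain B where B: "finite B" "B \<subseteq> grigorchuk_group" "id \<in> B" "g \<in> B" "\<forall>u\<in>B. grig_a \<circ> u \<in> B"
    "\<forall>u\<in>B. (adj B)\<^sup>*\<^sup>* id u" by blast
  let ?v = "s \<circ> g" and ?w = "grig_a \<circ> (s \<circ> g)"
  define C where "C = insert ?w (insert ?v B)"
  have "s \<in> grigorchuk_group" using step(1) by auto
  then have v: "?v \<in> grigorchuk_group" by (rule grig_comp[OF _ step(2)])
  have "?w \<in> grigorchuk_group" by (rule grig_comp[OF _ v]) simp
  then have C: "finite C" "C \<subseteq> grigorchuk_group" "id \<in> C" "s \<circ> g \<in> C" "\<forall>u\<in>C. grig_a \<circ> u \<in> C"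
    using B v by (auto simp: C_def)
  have old: "(adj C)\<^sup>*\<^sup>* id u" if "u \<in> B" for u
    using B(6) that adj_rtranclp_mono[of B id u C] by (auto simp: C_def)
  have "s \<in> insert grig_a klein" using step(1) by (auto simp: klein_def)
  then have "adj C g ?v" "adj C ?v ?w" unfolding adj_def using B(4) by (auto simp: C_def)
  then have "(adj C)\<^sup>*\<^sup>* id ?v" "(adj C)\<^sup>*\<^sup>* id ?w"
    using old[OF B(4)] by (meson rtranclp.rtrancl_into_rtrancl)+
  then have "\<forall>u\<in>C. (adj C)\<^sup>*\<^sup>* id u" using old by (auto simp: C_def)
  then show ?case using C by blast
qed

lemma finite_connected_superset:
  assumes "finite S" "S \<subseteq> grigorchuk_group"
  shows "\<exists>B. finite B \<and> B \<subseteq> grigorchuk_group \<and> id \<in> B \<and> S \<subseteq> B \<and> (\<forall>u\<in>B. grig_a \<circ> u \<in> B)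
    \<and> (\<forall>u\<in>B. (adj B)\<^sup>*\<^sup>* id u)"
  using assms
proof (induction S rule: finite_induct)
  case empty
  then show ?case using finite_connected_set[OF grig_generators(5)] by blast
next
  case (insert g S)
  then obtain B where B: "finite B" "B \<subseteq> grigorchuk_group" "id \<in> B" "S \<subseteq> B" "\<forall>u\<in>B. grig_a \<circ> u \<in> B"
    "\<forall>u\<in>B. (adj B)\<^sup>*\<^sup>* id u" by blast
  obtain C where C: "finite C" "C \<subseteq> grigorchuk_group" "g \<in> C" "\<forall>u\<in>C. grig_a \<circ> u \<in> C"
    "\<forall>u\<in>C. (adj C)\<^sup>*\<^sup>* id u" using finite_connected_set[of g] insert(4) by blast
  have "(adj (B \<union> C))\<^sup>*\<^sup>* id u" if "u \<in> B \<union> C" for u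
    using that
  proof
    assume "u \<in> B"
    then show ?thesis by (intro adj_rtranclp_mono[OF bspec[OF B(6)]]) simp_all
  next
    assume "u \<in> C"
    then show ?thesis by (intro adj_rtranclp_mono[OF bspec[OF C(5)]]) simp_all
  qed
  moreover have "finite (B \<union> C)" "B \<union> C \<subseteq> grigorchuk_group" "id \<in> B \<union> C" "insert g S \<subseteq> B \<union> C"
    "\<forall>u\<in>B \<union> C. grig_a \<circ> u \<in> B \<union> C" using B(1-5) C(1-4) by auto
  ultimately show ?case by blast
qed

text \<open>The union of the translates by \<open>H\<close> of a finite connected \<open>B\<close>
  containing \<open>id\<close> and the generators is connected: paths in \<open>B\<close> to
  generators, translated and concatenated, join \<open>id\<close> to all of \<open>H\<close>. Each
  orbit meets \<open>B\<close>.\<close>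

lemma core_exists:
  assumes H: "grig_subgroup H" and fg: "finitely_generated AutT H"
  shows "\<exists>Y. core H Y"
proof -
  obtain S where S: "finite S" "S \<subseteq> carrier AutT" "H = generate AutT S"
    using fg by (auto simp: finitely_generated_def)
  have SH: "S \<subseteq> H" using S(3) by (auto intro: generate.incl)
  have Sgrig: "S \<subseteq> grigorchuk_group" using SH H by (auto simp: grig_subgroup_def)
  obtain B where B: "finite B" "B \<subseteq> grigorchuk_group" "id \<in> B" "S \<subseteq> B" "\<forall>u\<in>B. grig_a \<circ> u \<in> B"
    "\<forall>u\<in>B. (adj B)\<^sup>*\<^sup>* id u" using finite_connected_superset[OF S(1) Sgrig] by blast
  define Y where "Y = {u \<circ> h | u h. u \<in> B \<and> h \<in> H}"
  have BY: "B \<subseteq> Y"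
  proof
    fix u assume "u \<in> B"
    then have "u = u \<circ> id \<and> u \<in> B \<and> id \<in> H" using grig_subgroup_id[OF H] by simp
    then show "u \<in> Y" unfolding Y_def by blast
  qed
  have YH: "u \<circ> h \<in> Y" if u: "u \<in> Y" and h: "h \<in> H" for u h
  proof -
    obtain w k where w: "u = w \<circ> k" "w \<in> B" "k \<in> H" using u unfolding Y_def by blast
    then have "u \<circ> h = w \<circ> (k \<circ> h)" by (simp add: comp_assoc)
    then show ?thesis unfolding Y_def using w grig_subgroup_comp[OF H w(3) h] by blast
  qed
  have Ya: "grig_a \<circ> u \<in> Y" if u: "u \<in> Y" for u
  proof -
    obtain w k where w: "u = w \<circ> k" "w \<in> B" "k \<in> H" using u unfolding Y_def by blast
    then have "grig_a \<circ> u = (grig_a \<circ> w) \<circ> k" by (simp add: comp_assoc)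
    then show ?thesis unfolding Y_def using w B(5) by blast
  qed
  let ?R = "(adj Y)\<^sup>*\<^sup>*"
  have trans: "?R u w \<Longrightarrow> ?R w z \<Longrightarrow> ?R u z" for u w z by (rule rtranclp_trans)
  have shift: "?R (u \<circ> h) (w \<circ> h)" if "?R u w" "h \<in> H" for u w h
    using adj_rtranclp_translate[OF that(1)] YH that(2) by blast
  have idB: "?R id u" if "u \<in> B" for u
    by (rule adj_rtranclp_mono[OF _ BY]) (use B(6) that in blast)
  have idH: "?R id h" if "h \<in> H" for h
    using that unfolding S(3)
  proof (induction rule: generate.induct)
    case (incl h)
    then show ?case using idB B(4) by blast
  next
    case (inv h)
    have t: "tree_aut h" using inv S(2) by auto
    have "inv\<^bsub>AutT\<^esub> h \<in> H" unfolding S(3) using inv by (rule generate.inv)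
    \<comment> \<open>The path from \<open>id\<close> to \<open>h\<close>, translated by the inverse
      of \<open>h\<close>, runs from that inverse to \<open>id\<close>.\<close>
    then have "?R (id \<circ> inv\<^bsub>AutT\<^esub> h) (h \<circ> inv\<^bsub>AutT\<^esub> h)" using shift idB B(4) inv by blast
    then have "?R (inv\<^bsub>AutT\<^esub> h) id" using AutT_m_inv(1)[OF t] by simp
    then have "?R id (inv\<^bsub>AutT\<^esub> h)" by (rule adj_rtranclp_sym)
    then show ?case by blast
  next
    case (eng h1 h2)
    have "?R (id \<circ> h1) (h2 \<circ> h1)" using shift[OF eng(4)] eng(1) S(3) by blast
    then have "?R h1 (h2 \<circ> h1)" by simp
    then have "?R id (h2 \<circ> h1)" using trans[OF eng(3)] by blast
    then show ?case unfolding AutT_simps by blast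
  next
    case one
    then show ?case unfolding AutT_simps by blast
  qed
  have idY: "?R id u" if u: "u \<in> Y" for u
  proof -
    obtain w k where w: "u = w \<circ> k" "w \<in> B" "k \<in> H" using u unfolding Y_def by blast
    have "?R (id \<circ> k) u" using shift[OF idB[OF w(2)] w(3)] w(1) by simp
    then have "?R k u" by simp
    then show ?thesis using trans[OF idH[OF w(3)]] by blast
  qed
  have "orb H ` Y \<subseteq> orb H ` B" using orb_comp[OF H] by (auto simp: Y_def)
  then have "finite (orb H ` Y)" by (rule finite_subset) (simp add: B)
  moreover have "Y \<subseteq> grigorchuk_group"
    using B(2) H grig_comp by (auto simp: Y_def grig_subgroup_def)
  moreover have "Y \<noteq> {}" using B(3) BY by blast
  moreover have "?R u w" if "u \<in> Y" "w \<in> Y" for u w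
    using trans[OF adj_rtranclp_sym[OF idY] idY] that by blast
  ultimately have "core H Y" using H Ya YH unfolding core_def by blast
  then show ?thesis ..
qed

subsection \<open>The Grigorchuk group is infinite\<close>

text \<open>At letter 1 the generators \<open>grig_b\<close>, \<open>grig_c\<close>,
  \<open>grig_d\<close> have sections \<open>grig_c\<close>, \<open>grig_d\<close>,
  \<open>grig_b\<close>, and the conjugate of \<open>grig_b\<close> by \<open>grig_a\<close> has
  section \<open>grig_a\<close>.\<close>

lemma grig_sec_surj:
  assumes "g \<in> grigorchuk_group"
  shows "\<exists>h\<in>grigorchuk_group. letter_image h True = True \<and> sec True h = g"
  using assms
proof (induction rule: grig_induct)
  case one
  have "letter_image id True = True" "sec True id = id" by simp_all
  then show ?case using grig_generators(5) by blast
next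
  case (step s g)
  then obtain h where h: "h \<in> grigorchuk_group" "letter_image h True = True" "sec True h = g" by blast
  note t = grig_tree_aut[OF h(1)]
  have lift: ?case if k: "k \<in> grigorchuk_group" "letter_image k True = True" "sec True k = s" for k
  proof -
    have "letter_image (k \<circ> h) True = True" "sec True (k \<circ> h) = s \<circ> g"
      using letter_image_comp[OF t, of k True] sec_comp[OF t grig_tree_aut[OF k(1)], of True] h k by auto
    then show ?thesis using grig_comp[OF k(1) h(1)] by blast
  qed
  have aba: "letter_image (grig_a \<circ> (grig_b \<circ> grig_a)) True = True"
    "sec True (grig_a \<circ> (grig_b \<circ> grig_a)) = grig_a"
    by (simp_all add: letter_image_comp sec_comp tree_aut_comp)
  have "grig_a \<circ> (grig_b \<circ> grig_a) \<in> grigorchuk_group" by (intro grig_comp) simp_all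
  then show ?case using step(1) lift aba lift[of grig_b] lift[of grig_c] lift[of grig_d] by auto
qed

text \<open>A proper subgroup, the stabiliser of letter 1, maps onto the whole group, which is
  impossible in a finite group.\<close>

lemma infinite_grig: "infinite grigorchuk_group"
proof
  assume fin: "finite grigorchuk_group"
  let ?K = "{h \<in> grigorchuk_group. letter_image h True = True}"
  have "grigorchuk_group \<subseteq> sec True ` ?K" using grig_sec_surj by blast
  then have "card grigorchuk_group \<le> card ?K"
    using fin by (intro surj_card_le) simp_all
  then have "?K = grigorchuk_group" using fin by (intro card_seteq) auto
  moreover have "grig_a \<notin> ?K" by simp
  ultimately show False using grig_generators(1) by blast
qed

text \<open>Sections of a finite \<open>H\<close> are finite, so none is the infinite Grigorchuk
  group; conversely, an infinite \<open>H\<close> has a core, from which the descent finds a full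
  section.\<close>

theorem theorem4:
  fixes H :: "(word \<Rightarrow> word) set"
  assumes "subgroup H AutT" and "H \<subseteq> grigorchuk_group"
    and "finitely_generated AutT H"
  shows "finite H \<longleftrightarrow> (\<nexists>v. vertex_section H v = grigorchuk_group)"
proof
  assume "finite H"
  then have "finite (vertex_section H v)" for v by (simp add: vertex_section_def)
  then show "\<nexists>v. vertex_section H v = grigorchuk_group" using infinite_grig by metis
next
  assume none: "\<nexists>v. vertex_section H v = grigorchuk_group"
  have "grig_subgroup H" using assms by (simp add: grig_subgroup_def)
  then obtain Y where "core H Y" using core_exists assms(3) by blast
  then show "finite H" using core_full_section none by blast
qed

end
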